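(* Let $D\subset\mathbb{C}^n$ be a bounded homogeneous domain with Bergman distance $\rho$, and let $f:D\to\mathbb{C}$ be holomorphic. Then $f$ is a Bloch function if and only if $f$ is a Lipschitz map from $(D,\rho)$ to $\mathbb{C}$ with the Euclidean metric. Furthermore, $$\beta_f=\sup_{z,w\in D,\ z\ne w}\frac{|f(z)-f(w)|}{\rho(z,w)}.$$
   Context: A domain $D\subset\mathbb{C}^n$ is homogeneous if its group $\mathrm{Aut}(D)$ of biholomorphic self-maps acts transitively on $D$. For a bounded homogeneous domain $D$, $H_z(u,\overline v)$ ($z\in D$, $u,v\in\mathbb{C}^n$) denotes the Bergman metric, a positive definite Hermitian form invariant under automorphisms, normalized by $H_z(u,\overline v)=\frac12\sum_{j,k}\frac{\partial^2\log K(z,z)}{\partial z_j\partial\overline{z_k}}u_j\overline{v_k}$ with $K$ the Bergman kernel of $D$ (so on the unit disk $H_z(u,\overline u)=|u|^2/(1-|z|^2)^2$). The Bergman distance $\rho(z,w)$ is the infimum of $\int_0^1 H_{\gamma(t)}(\gamma'(t),\overline{\gamma'(t)})^{1/2}dt$ over piecewise smooth curves $\gamma:[0,1]\to D$ from $z$ to $w$. For holomorphic $f:D\to\mathbb{C}$ put $$Q_f(z)=\sup_{u\in\mathbb{C}^n\setminus\{0\}}\frac{|(\nabla f)(z)u|}{H_z(u,\overline u)^{1/2}},\qquad (\nabla f)(z)u=\sum_{k=1}^n\frac{\partial f}{\partial z_k}(z)u_k,\qquad \beta_f=\sup_{z\in D}Q_f(z).$$ The function $f$ is Bloch if $\beta_f<\infty$.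 *)

theory Defs
  imports "HOL-Analysis.Analysis"
begin

section \<open>Holomorphic functions and maps in several variables\<close>

definition holomorphic_scv :: "(complex ^ 'n) set \<Rightarrow> (complex ^ 'n \<Rightarrow> complex) \<Rightarrow> bool" where
  "holomorphic_scv D f \<longleftrightarrow>
     (\<forall>z\<in>D. \<exists>f'. (f has_derivative f') (at z) \<and> (\<forall>c v. f' (c *s v) = c * f' v))"

definition automorphisms :: "(complex ^ 'n) set \<Rightarrow> (complex ^ 'n \<Rightarrow> complex ^ 'n) set" where
  "automorphisms D =
     {\<phi>. bij_betw \<phi> D D \<and>
         (\<forall>i. holomorphic_scv D (\<lambda>z. \<phi> z $ i)) \<and>
         (\<exists>\<psi>. (\<forall>i. holomorphic_scv D (\<lambda>z. \<psi> z $ i)) \<and> (\<forall>z\<in>D. \<psi> (\<phi> z) = z))}"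

definition bounded_homogeneous_domain :: "(complex ^ 'n) set \<Rightarrow> bool" where
  "bounded_homogeneous_domain D \<longleftrightarrow>
     open D \<and> connected D \<and> D \<noteq> {} \<and> bounded D \<and>
     (\<forall>z\<in>D. \<forall>w\<in>D. \<exists>\<phi>\<in>automorphisms D. \<phi> z = w)"

section \<open>Wirtinger derivatives\<close>

definition dir_deriv :: "complex ^ 'n \<Rightarrow> (complex ^ 'n \<Rightarrow> complex) \<Rightarrow> complex ^ 'n \<Rightarrow> complex" where
  "dir_deriv v g z = vector_derivative (\<lambda>t::real. g (z + t *\<^sub>R v)) (at 0)"

text \<open>With $z_j = x_j + i y_j$, the directions \<open>axis j 1\<close> and \<open>axis j \<i>\<close> give
  $\partial/\partial x_j$ and $\partial/\partial y_j$.\<close>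

definition wirtinger :: "'n \<Rightarrow> (complex ^ 'n \<Rightarrow> complex) \<Rightarrow> complex ^ 'n \<Rightarrow> complex" where
  "wirtinger j g z = (dir_deriv (axis j 1) g z - \<i> * dir_deriv (axis j \<i>) g z) / 2"

definition wirtinger_bar :: "'n \<Rightarrow> (complex ^ 'n \<Rightarrow> complex) \<Rightarrow> complex ^ 'n \<Rightarrow> complex" where
  "wirtinger_bar j g z = (dir_deriv (axis j 1) g z + \<i> * dir_deriv (axis j \<i>) g z) / 2"

section \<open>Bergman kernel, metric and distance\<close>

definition bergman_space :: "(complex ^ 'n) set \<Rightarrow> (complex ^ 'n \<Rightarrow> complex) set" where
  "bergman_space D =
     {f. holomorphic_scv D f \<and> set_integrable lborel D (\<lambda>z. (cmod (f z))\<^sup>2)}"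

text \<open>\<open>bergman_kernel D z w\<close> is $K(z,w)$, where $K(\cdot,w)$ is the element of the Bergman space
  that reproduces evaluation at $w$. That element is only determined on \<open>D\<close>, hence the definite
  description is applied to its value at \<open>z \<in> D\<close> rather than to the function.\<close>

definition bergman_kernel :: "(complex ^ 'n) set \<Rightarrow> complex ^ 'n \<Rightarrow> complex ^ 'n \<Rightarrow> complex" where
  "bergman_kernel D z w =
     (THE c. \<exists>k\<in>bergman_space D.
        (\<forall>f\<in>bergman_space D. f w = (LINT x:D|lborel. f x * cnj (k x))) \<and> c = k z)"

text \<open>$\log K(z,z)$; on a bounded domain $K(z,z)$ is real and positive.\<close>

definition log_kernel :: "(complex ^ 'n) set \<Rightarrow> complex ^ 'n \<Rightarrow> complex" where
  "log_kernel D z = complex_of_real (ln (Re (bergman_kernel D z z)))"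

text \<open>\<open>bergman_metric D z u v\<close> is $H_z(u,\overline v)$: the conjugation of the second
  vector argument is part of the definition.\<close>

definition bergman_metric ::
    "(complex ^ 'n) set \<Rightarrow> complex ^ 'n \<Rightarrow> complex ^ 'n \<Rightarrow> complex ^ 'n \<Rightarrow> complex" where
  "bergman_metric D z u v =
     1/2 * (\<Sum>j\<in>UNIV. \<Sum>k\<in>UNIV.
              wirtinger j (wirtinger_bar k (log_kernel D)) z * u $ j * cnj (v $ k))"

definition bergman_norm :: "(complex ^ 'n) set \<Rightarrow> complex ^ 'n \<Rightarrow> complex ^ 'n \<Rightarrow> real" where
  "bergman_norm D z u = sqrt (Re (bergman_metric D z u u))"

definition smooth_on_interval :: "real \<Rightarrow> real \<Rightarrow> (real \<Rightarrow> complex ^ 'n) \<Rightarrow> bool" where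
  "smooth_on_interval a b \<gamma> \<longleftrightarrow>
     (\<exists>g :: nat \<Rightarrow> real \<Rightarrow> complex ^ 'n.
        (\<forall>t\<in>{a..b}. g 0 t = \<gamma> t) \<and>
        (\<forall>m. \<forall>t\<in>{a..b}. (g m has_vector_derivative g (Suc m) t) (at t within {a..b})))"

text \<open>All derivatives exist up to and including the end points of the closed pieces. This is
  stronger than \<^const>\<open>piecewise_C1_differentiable_on\<close>, which permits an unbounded
  derivative near a break point and hence curves of infinite length.\<close>

definition piecewise_smooth :: "(real \<Rightarrow> complex ^ 'n) \<Rightarrow> bool" where
  "piecewise_smooth \<gamma> \<longleftrightarrow>
     continuous_on {0..1} \<gamma> \<and>
     (\<exists>S. finite S \<and> {0, 1} \<subseteq> S \<and> S \<subseteq> {0..1} \<and>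
        (\<forall>a\<in>S. \<forall>b\<in>S. a < b \<and> S \<inter> {a<..<b} = {} \<longrightarrow> smooth_on_interval a b \<gamma>))"

definition bergman_length :: "(complex ^ 'n) set \<Rightarrow> (real \<Rightarrow> complex ^ 'n) \<Rightarrow> real" where
  "bergman_length D \<gamma> =
     integral {0..1} (\<lambda>t. bergman_norm D (\<gamma> t) (vector_derivative \<gamma> (at t)))"

definition bergman_dist :: "(complex ^ 'n) set \<Rightarrow> complex ^ 'n \<Rightarrow> complex ^ 'n \<Rightarrow> real" where
  "bergman_dist D z w =
     Inf {bergman_length D \<gamma> | \<gamma>.
            piecewise_smooth \<gamma> \<and> \<gamma> ` {0..1} \<subseteq> D \<and> \<gamma> 0 = z \<and> \<gamma> 1 = w}"

section \<open>Bloch functions\<close>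

definition grad_apply :: "(complex ^ 'n \<Rightarrow> complex) \<Rightarrow> complex ^ 'n \<Rightarrow> complex ^ 'n \<Rightarrow> complex" where
  "grad_apply f z u = (\<Sum>k\<in>UNIV. wirtinger k f z * u $ k)"

definition bloch_Q :: "(complex ^ 'n) set \<Rightarrow> (complex ^ 'n \<Rightarrow> complex) \<Rightarrow> complex ^ 'n \<Rightarrow> ereal" where
  "bloch_Q D f z = (SUP u\<in>UNIV - {0}. ereal (cmod (grad_apply f z u) / bergman_norm D z u))"

definition bloch_const :: "(complex ^ 'n) set \<Rightarrow> (complex ^ 'n \<Rightarrow> complex) \<Rightarrow> ereal" where
  "bloch_const D f = (SUP z\<in>D. bloch_Q D f z)"

definition is_bloch :: "(complex ^ 'n) set \<Rightarrow> (complex ^ 'n \<Rightarrow> complex) \<Rightarrow> bool" where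
  "is_bloch D f \<longleftrightarrow> bloch_const D f < \<infinity>"

definition bergman_lipschitz :: "(complex ^ 'n) set \<Rightarrow> (complex ^ 'n \<Rightarrow> complex) \<Rightarrow> bool" where
  "bergman_lipschitz D f \<longleftrightarrow>
     (\<exists>L. \<forall>z\<in>D. \<forall>w\<in>D. dist (f z) (f w) \<le> L * bergman_dist D z w)"

end

theory Submission
  imports Defs "HOL-Complex_Analysis.Cauchy_Integral_Formula"
begin

text \<open>If \<open>|\<nabla>f(z)u| \<le> b H\<^sub>z(u,u)\<^sup>1\<^sup>/\<^sup>2\<close> everywhere, integrating \<open>(f \<circ> \<gamma>)'\<close> along a curve \<open>\<gamma>\<close> in
  \<open>D\<close> gives \<open>|f(z) - f(w)| \<le> b \<rho>(z,w)\<close>. Conversely, a segment from \<open>z\<close> to \<open>z + tu\<close> has length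
  \<open>t (H\<^sub>z(u,u)\<^sup>1\<^sup>/\<^sup>2 + o(1))\<close>, so that a Lipschitz bound for \<open>f\<close> with constant \<open>b\<close> implies the bound
  for the derivative. Hence the two suprema have the same finite upper bounds and are equal.

  Three properties of the Bergman metric make this work: it is continuous, so that lengths are
  integrals of integrable functions and the second half holds; it is positive definite, so that a
  quotient by \<open>H\<^sub>z(u,u)\<^sup>1\<^sup>/\<^sup>2\<close> controls the derivative; and \<open>\<rho>\<close> separates points, so that a quotient
  by \<open>\<rho>(z,w)\<close> controls the increment. They are derived here from the definition of the kernel by
  Hilbert space duality.

  Averaging the mean value property over circles shows that point evaluations are bounded on the
  Bergman space (\<open>evaluation_bound\<close>); Cauchy's inequality extends this to derivatives, with
  Taylor estimates that are uniform over the unit ball of the space (\<open>local_estimates\<close>).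
  Consequently the space is complete (\<open>A2_complete\<close>), evaluations and derivatives have representers
  (\<open>riesz_representation\<close>), and the representers depend differentiably on the point
  (\<open>ker_estimates\<close>). With \<open>k\<close> and \<open>d\<close> the representers of \<open>f \<mapsto> f(z)\<close> and \<open>f \<mapsto> \<nabla>f(z)u\<close>,
  differentiating \<open>ln \<parallel>k\<parallel>\<^sup>2\<close> twice yields the Gram determinant
  \<open>H\<^sub>z(u,u) = (\<parallel>d\<parallel>\<^sup>2\<parallel>k\<parallel>\<^sup>2 - |\<langle>d,k\<rangle>|\<^sup>2) / (2\<parallel>k\<parallel>\<^sup>4)\<close> (\<open>bergman_metric_gram\<close>). Continuity of the
  representers gives continuity of \<open>H\<close>, and testing against \<open>x \<mapsto> \<langle>x - z, u\<rangle> K(x,z)\<close> gives a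
  uniform lower bound \<open>H\<^sub>z(u,u) \<ge> |u|\<^sup>2 / (2B\<^sup>2)\<close> with \<open>B\<close> a bound for the diameter of \<open>D\<close>
  (\<open>bergman_norm_lower_bound\<close>). The lower bound makes the coordinate functions Lipschitz for
  \<open>\<rho>\<close>, which is why \<open>\<rho>\<close> separates points.\<close>

section \<open>Holomorphic functions of several variables\<close>

lemma norm_cvec_scale: "norm (c *s (v :: complex ^ 'n)) = cmod c * norm v"
  by (simp add: norm_vec_def L2_set_def norm_mult power_mult_distrib sum_distrib_left[symmetric]
      real_sqrt_mult)

lemma of_real_cvec_scale: "complex_of_real r *s (v :: complex ^ 'n) = r *\<^sub>R v"
  by (simp add: vec_eq_iff) (simp add: scaleR_conv_of_real)

lemma bounded_linear_cvec_scale_left: "bounded_linear (\<lambda>c. c *s (v :: complex ^ 'n))"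
  by (rule bounded_linear_intro[where K = "norm v"])
    (auto simp: norm_cvec_scale vec_eq_iff algebra_simps)

lemma axis_scale_one: "axis k c = c *s (axis k 1 :: complex ^ 'n)"
  by (simp add: vec_eq_iff axis_def)

lemma dir_deriv_eq:
  assumes "(f has_derivative f') (at z)"
  shows "dir_deriv v f z = f' v"
proof -
  have "((\<lambda>t::real. z + t *\<^sub>R v) has_derivative (\<lambda>t. t *\<^sub>R v)) (at 0)"
    by (auto intro!: derivative_eq_intros)
  moreover have "(f has_derivative f') (at (z + 0 *\<^sub>R v))"
    using assms by simp
  ultimately have "((\<lambda>t. f (z + t *\<^sub>R v)) has_derivative (\<lambda>t. f' (t *\<^sub>R v))) (at 0)"
    by (rule has_derivative_compose)
  moreover have "f' (t *\<^sub>R v) = t *\<^sub>R f' v" for t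
    using has_derivative_bounded_linear[OF assms] by (simp add: linear_simps)
  ultimately have "((\<lambda>t. f (z + t *\<^sub>R v)) has_vector_derivative f' v) (at 0)"
    by (simp add: has_vector_derivative_def)
  then show ?thesis
    unfolding dir_deriv_def by (rule vector_derivative_at)
qed

lemma grad_apply_eq:
  fixes f :: "complex ^ 'n \<Rightarrow> complex"
  assumes "(f has_derivative f') (at z)" "\<And>c v. f' (c *s v) = c * f' v"
  shows "grad_apply f z = f'"
proof
  fix u :: "complex ^ 'n"
  have "wirtinger k f z = f' (axis k 1)" for k
    by (simp add: wirtinger_def dir_deriv_eq[OF assms(1)] axis_scale_one[of k \<i>] assms(2))
  then have "grad_apply f z u = (\<Sum>k\<in>UNIV. f' ((u $ k) *s axis k 1))"
    by (simp add: grad_apply_def assms(2) mult.commute)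
  also have "\<dots> = f' (\<Sum>k\<in>UNIV. (u $ k) *s axis k 1)"
    using has_derivative_linear[OF assms(1)] by (simp add: linear_sum)
  also have "(\<Sum>k\<in>UNIV. (u $ k) *s axis k 1) = u"
    by (rule basis_expansion)
  finally show "grad_apply f z u = f' u" .
qed

lemma grad_apply_scale: "grad_apply f z (c *s u) = c * grad_apply f z u"
  by (simp add: grad_apply_def sum_distrib_left mult.left_commute)

lemma grad_apply_scaleR: "grad_apply f z (r *\<^sub>R u) = r *\<^sub>R grad_apply f z u"
  by (simp add: of_real_cvec_scale[symmetric] grad_apply_scale scaleR_conv_of_real)

lemma grad_apply_axis: "grad_apply f z (axis k 1) = wirtinger k f z"
  by (simp add: grad_apply_def axis_def if_distrib[of "\<lambda>x. _ * x"] cong: if_cong)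

lemma grad_apply_zero [simp]: "grad_apply f z 0 = 0"
  by (simp add: grad_apply_def)

lemma holomorphic_scv_iff:
  "holomorphic_scv D f \<longleftrightarrow> (\<forall>z\<in>D. (f has_derivative grad_apply f z) (at z))"
proof
  assume "holomorphic_scv D f"
  then show "\<forall>z\<in>D. (f has_derivative grad_apply f z) (at z)"
    unfolding holomorphic_scv_def by (metis grad_apply_eq)
next
  assume "\<forall>z\<in>D. (f has_derivative grad_apply f z) (at z)"
  then show "holomorphic_scv D f"
    unfolding holomorphic_scv_def using grad_apply_scale by blast
qed

lemma holomorphic_scv_derivative:
  "holomorphic_scv D f \<Longrightarrow> z \<in> D \<Longrightarrow> (f has_derivative grad_apply f z) (at z)"
  by (simp add: holomorphic_scv_iff)

lemma holomorphic_scv_continuous_on: "holomorphic_scv D f \<Longrightarrow> continuous_on D f"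
  by (meson continuous_at_imp_continuous_on has_derivative_continuous holomorphic_scv_derivative)

lemma
  assumes "holomorphic_scv D f" "holomorphic_scv D g"
  shows holomorphic_scv_add: "holomorphic_scv D (\<lambda>z. f z + g z)"
    and holomorphic_scv_diff: "holomorphic_scv D (\<lambda>z. f z - g z)"
    and holomorphic_scv_mult: "holomorphic_scv D (\<lambda>z. f z * g z)"
    and grad_apply_diff:
      "z \<in> D \<Longrightarrow> grad_apply (\<lambda>z. f z - g z) z u = grad_apply f z u - grad_apply g z u"
    and grad_apply_mult:
      "z \<in> D \<Longrightarrow> grad_apply (\<lambda>z. f z * g z) z u = f z * grad_apply g z u + grad_apply f z u * g z"
proof -
  have add: "((\<lambda>z. f z + g z) has_derivative (\<lambda>u. grad_apply f z u + grad_apply g z u)) (at z)"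
    and diff: "((\<lambda>z. f z - g z) has_derivative (\<lambda>u. grad_apply f z u - grad_apply g z u)) (at z)"
    and mult: "((\<lambda>z. f z * g z) has_derivative
      (\<lambda>u. f z * grad_apply g z u + grad_apply f z u * g z)) (at z)"
    if "z \<in> D" for z
    using assms that
    by (auto intro!: derivative_eq_intros simp: holomorphic_scv_iff)
  show "holomorphic_scv D (\<lambda>z. f z + g z)" "holomorphic_scv D (\<lambda>z. f z - g z)"
    "holomorphic_scv D (\<lambda>z. f z * g z)"
    unfolding holomorphic_scv_def
    by (intro ballI exI conjI, erule add diff mult, simp add: grad_apply_scale algebra_simps)+
  show "z \<in> D \<Longrightarrow> grad_apply (\<lambda>z. f z - g z) z u = grad_apply f z u - grad_apply g z u"
    by (subst grad_apply_eq[OF diff]) (simp_all add: grad_apply_scale algebra_simps)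
  show "z \<in> D \<Longrightarrow> grad_apply (\<lambda>z. f z * g z) z u = f z * grad_apply g z u + grad_apply f z u * g z"
    by (subst grad_apply_eq[OF mult]) (simp_all add: grad_apply_scale algebra_simps)
qed

lemma grad_apply_const [simp]: "grad_apply (\<lambda>z. c) z u = 0"
  by (subst grad_apply_eq[OF has_derivative_const]) auto

lemma holomorphic_scv_const: "holomorphic_scv D (\<lambda>z. c)"
  by (simp add: holomorphic_scv_iff grad_apply_const[abs_def])

lemma
  shows holomorphic_scv_component: "holomorphic_scv D (\<lambda>z. z $ i)"
    and grad_apply_component: "grad_apply (\<lambda>z. z $ i) z u = u $ i"
proof -
  have 1: "((\<lambda>z. z $ i) has_derivative (\<lambda>u. u $ i)) (at z)" for z :: "complex ^ 'm" and i
    by (rule bounded_linear_imp_has_derivative) (rule bounded_linear_vec_nth)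
  show "holomorphic_scv D (\<lambda>z. z $ i)"
    unfolding holomorphic_scv_def by (intro ballI exI conjI, rule 1) simp
  show "grad_apply (\<lambda>z. z $ i) z u = u $ i"
    by (subst grad_apply_eq[OF 1]) auto
qed

lemma has_field_derivative_complex_line:
  fixes f :: "complex ^ 'n \<Rightarrow> complex"
  assumes "holomorphic_scv D f" "x + c *s u \<in> D"
  shows "((\<lambda>c. f (x + c *s u)) has_field_derivative grad_apply f (x + c *s u) u) (at c)"
proof -
  have "((\<lambda>c. x + c *s u) has_derivative (\<lambda>c. c *s u)) (at c)"
    by (auto intro!: derivative_eq_intros
        bounded_linear_imp_has_derivative bounded_linear_cvec_scale_left)
  from has_derivative_compose[OF this holomorphic_scv_derivative[OF assms]]
  show ?thesis
    unfolding has_field_derivative_def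
    by (rule has_derivative_eq_rhs) (auto simp: grad_apply_scale)
qed

text \<open>Cauchy's inequality on the complex line through \<open>x\<close> in direction \<open>u\<close>; all estimates for
  derivatives in this theory come from it.\<close>

lemma Cauchy_inequality_grad:
  fixes f :: "complex ^ 'n \<Rightarrow> complex"
  assumes hol: "holomorphic_scv D f" and sub: "cball x s \<subseteq> D" and "s > 0"
    and M: "\<And>y. y \<in> cball x s \<Longrightarrow> cmod (f y) \<le> M"
  shows "cmod (grad_apply f x u) \<le> M / s * norm u"
proof (cases "u = 0")
  case False
  define R where "R = s / norm u"
  have "R > 0" using False \<open>s > 0\<close> by (simp add: R_def)
  have line: "x + c *s u \<in> cball x s" if "c \<in> cball 0 R" for c
    using that False by (simp add: dist_norm norm_cvec_scale R_def field_simps)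
  define g where "g = (\<lambda>c. f (x + c *s u))"
  have der: "(g has_field_derivative grad_apply f (x + c *s u) u) (at c)" if "c \<in> cball 0 R" for c
    unfolding g_def by (rule has_field_derivative_complex_line[OF hol]) (use line that sub in blast)
  have "g holomorphic_on cball 0 R"
    by (meson der has_field_derivative_at_within holomorphic_on_def field_differentiable_def)
  then have "norm ((deriv ^^ 1) g 0) \<le> fact 1 * M / R ^ 1"
    by (intro Cauchy_inequality)
      (auto intro: holomorphic_on_imp_continuous_on holomorphic_on_subset \<open>R > 0\<close>
        simp: g_def intro!: M line)
  moreover have "deriv g 0 = grad_apply f x u"
    using DERIV_imp_deriv[OF der[of 0]] \<open>R > 0\<close> by simp
  ultimately show ?thesis
    using False \<open>s > 0\<close> by (simp add: R_def field_simps)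
qed simp

text \<open>Cauchy's inequality makes the derivatives locally uniformly Cauchy, so that they may be
  passed to the limit; complex linearity survives the limit.\<close>

lemma holomorphic_scv_uniform_limit:
  fixes F :: "nat \<Rightarrow> complex ^ 'n \<Rightarrow> complex"
  assumes "open D" and hol: "\<And>n. holomorphic_scv D (F n)"
    and lim: "\<And>z. z \<in> D \<Longrightarrow> \<exists>r>0. uniform_limit (ball z r) F f sequentially"
  shows "holomorphic_scv D f"
    and "z \<in> D \<Longrightarrow> (\<lambda>n. grad_apply (F n) z u) \<longlonglongrightarrow> grad_apply f z u"
proof -
  have *: "(f has_derivative grad_apply f z) (at z) \<and>
      (\<forall>u. (\<lambda>n. grad_apply (F n) z u) \<longlonglongrightarrow> grad_apply f z u)"
    if z: "z \<in> D" for z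
  proof -
    obtain r0 where r0: "r0 > 0" "uniform_limit (ball z r0) F f sequentially"
      using lim[OF z] by blast
    obtain r1 where r1: "r1 > 0" "ball z r1 \<subseteq> D"
      using \<open>open D\<close> z openE by blast
    define r where "r = min r0 r1 / 3"
    have "r > 0" using r0 r1 by (simp add: r_def)
    have in_ball: "cball x r \<subseteq> ball z r0 \<inter> D" if "x \<in> ball z r" for x
    proof
      fix y assume "y \<in> cball x r"
      then have "dist z y < 3 * r"
        using that dist_triangle[of z y x] \<open>r > 0\<close> by auto
      then show "y \<in> ball z r0 \<inter> D"
        using r1 by (auto simp: r_def subset_iff)
    qed
    define G where "G = (\<lambda>x u. lim (\<lambda>n. grad_apply (F n) x u))"
    have cauchy: "\<exists>N. \<forall>m\<ge>N. \<forall>n\<ge>N. \<forall>x\<in>ball z r. \<forall>u.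
        cmod (grad_apply (F m) x u - grad_apply (F n) x u) \<le> e * norm u"
      if "e > 0" for e
    proof -
      have "0 < e * r / 2" using that \<open>r > 0\<close> by simp
      then obtain N where N: "\<And>n y. n \<ge> N \<Longrightarrow> y \<in> ball z r0 \<Longrightarrow> cmod (F n y - f y) < e * r / 2"
        using uniform_limitD[OF r0(2)] unfolding eventually_sequentially dist_norm by metis
      have "cmod (grad_apply (F m) x u - grad_apply (F n) x u) \<le> e * norm u"
        if "m \<ge> N" "n \<ge> N" "x \<in> ball z r" for m n x u
      proof -
        have "cmod (grad_apply (\<lambda>y. F m y - F n y) x u) \<le> (e * r) / r * norm u"
        proof (rule Cauchy_inequality_grad)
          show "holomorphic_scv D (\<lambda>y. F m y - F n y)"
            by (rule holomorphic_scv_diff) (rule hol)+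
          show "cball x r \<subseteq> D" using in_ball that by blast
          fix y assume "y \<in> cball x r"
          then have "y \<in> ball z r0" using in_ball that by blast
          then have "cmod (F m y - f y) < e * r / 2" "cmod (F n y - f y) < e * r / 2"
            using N that by blast+
          then show "cmod (F m y - F n y) \<le> e * r"
            using norm_triangle_ineq4[of "F m y - f y" "F n y - f y"] by simp
        qed (use \<open>r > 0\<close> in auto)
        moreover have "x \<in> D" using in_ball[OF that(3)] \<open>r > 0\<close> by auto
        ultimately show ?thesis
          using \<open>r > 0\<close> by (simp add: grad_apply_diff[OF hol hol])
      qed
      then show ?thesis by blast
    qed
    have G: "(\<lambda>n. grad_apply (F n) x u) \<longlonglongrightarrow> G x u" if "x \<in> ball z r" for x u
    proof -
      have "Cauchy (\<lambda>n. grad_apply (F n) x u)"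
      proof (rule metric_CauchyI)
        fix e :: real assume "e > 0"
        then have "e / (norm u + 1) > 0"
          by (intro divide_pos_pos) (auto simp: add_nonneg_pos)
        from cauchy[OF this] obtain N where "\<forall>m\<ge>N. \<forall>n\<ge>N. \<forall>x\<in>ball z r. \<forall>v.
            cmod (grad_apply (F m) x v - grad_apply (F n) x v) \<le> e / (norm u + 1) * norm v"
          by (rule exE) (rule that)
        with that have N: "cmod (grad_apply (F m) x u - grad_apply (F n) x u)
            \<le> e / (norm u + 1) * norm u" if "m \<ge> N" "n \<ge> N" for m n
          using that by blast
        have "e / (norm u + 1) * norm u < e"
          using \<open>e > 0\<close> add_nonneg_pos[OF norm_ge_zero[of u] zero_less_one]
          by (simp add: field_simps)
        then show "\<exists>N. \<forall>m\<ge>N. \<forall>n\<ge>N. dist (grad_apply (F m) x u) (grad_apply (F n) x u) < e"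
          using N by (auto simp: dist_norm intro!: exI[of _ N] intro: le_less_trans)
      qed
      then show ?thesis
        unfolding G_def by (simp add: Cauchy_convergent convergent_LIMSEQ_iff[symmetric])
    qed
    have "\<exists>g. \<forall>x\<in>ball z r. (\<lambda>n. F n x) \<longlonglongrightarrow> g x \<and> (g has_derivative G x) (at x within ball z r)"
    proof (rule has_derivative_sequence)
      show "convex (ball z r)" by simp
      show "(F n has_derivative grad_apply (F n) x) (at x within ball z r)" if "x \<in> ball z r" for n x
      proof -
        have "x \<in> D" using in_ball[OF that] \<open>r > 0\<close> by auto
        then show ?thesis
          using hol holomorphic_scv_derivative has_derivative_at_withinI by blast
      qed
      show "\<forall>\<^sub>F n in sequentially. \<forall>x\<in>ball z r. \<forall>h.
          cmod (grad_apply (F n) x h - G x h) \<le> e * norm h" if "e > 0" for e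
      proof -
        from cauchy[OF that] obtain N where N: "\<And>m n x u. m \<ge> N \<Longrightarrow> n \<ge> N \<Longrightarrow> x \<in> ball z r \<Longrightarrow>
            cmod (grad_apply (F m) x u - grad_apply (F n) x u) \<le> e * norm u"
          by blast
        have "cmod (grad_apply (F n) x h - G x h) \<le> e * norm h"
          if "n \<ge> N" "x \<in> ball z r" for n x h
        proof (rule LIMSEQ_le_const2)
          show "(\<lambda>m. cmod (grad_apply (F n) x h - grad_apply (F m) x h))
              \<longlonglongrightarrow> cmod (grad_apply (F n) x h - G x h)"
            by (intro tendsto_intros G that)
          show "\<exists>M. \<forall>m\<ge>M. cmod (grad_apply (F n) x h - grad_apply (F m) x h) \<le> e * norm h"
            using N that by blast
        qed
        then show ?thesis unfolding eventually_sequentially by blast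
      qed
      show "z \<in> ball z r" using \<open>r > 0\<close> by simp
      show "(\<lambda>n. F n z) \<longlonglongrightarrow> f z"
        using tendsto_uniform_limitI[OF r0(2), of z] \<open>r0 > 0\<close> by simp
    qed
    then obtain g where g: "\<And>x. x \<in> ball z r \<Longrightarrow> (\<lambda>n. F n x) \<longlonglongrightarrow> g x"
        "\<And>x. x \<in> ball z r \<Longrightarrow> (g has_derivative G x) (at x within ball z r)"
      by blast
    have "g x = f x" if "x \<in> ball z r" for x
    proof -
      have "x \<in> cball x r" using \<open>r > 0\<close> by simp
      then have "x \<in> ball z r0" using in_ball[OF that] by blast
      then show ?thesis
        using tendsto_uniform_limitI[OF r0(2)] g(1)[OF that] LIMSEQ_unique by blast
    qed
    moreover have "(g has_derivative G z) (at z)"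
      using g(2)[of z] \<open>r > 0\<close> at_within_open[of z "ball z r"] by simp
    ultimately have der: "(f has_derivative G z) (at z)"
      using has_derivative_transform_within_open[of g "G z" z UNIV "ball z r" f] \<open>r > 0\<close> by auto
    have Gz: "(\<lambda>n. grad_apply (F n) z u) \<longlonglongrightarrow> G z u" for u
      using G \<open>r > 0\<close> by simp
    have "G z (c *s v) = c * G z v" for c v
      using LIMSEQ_unique[OF Gz[of "c *s v"]] tendsto_mult_left[OF Gz[of v], of c]
      by (simp add: grad_apply_scale)
    then have "grad_apply f z = G z"
      by (rule grad_apply_eq[OF der])
    then show ?thesis using der Gz by simp
  qed
  then show "holomorphic_scv D f" by (simp add: holomorphic_scv_iff)
  show "z \<in> D \<Longrightarrow> (\<lambda>n. grad_apply (F n) z u) \<longlonglongrightarrow> grad_apply f z u"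
    using * by blast
qed

section \<open>Derivatives of holomorphic functions are holomorphic\<close>

lemma
  assumes "holomorphic_scv D f"
  shows holomorphic_scv_cmult: "holomorphic_scv D (\<lambda>z. c * f z)"
    and grad_apply_cmult: "z \<in> D \<Longrightarrow> grad_apply (\<lambda>z. c * f z) z u = c * grad_apply f z u"
  using holomorphic_scv_mult[OF holomorphic_scv_const assms]
    grad_apply_mult[OF holomorphic_scv_const assms] by simp_all

lemma
  assumes "holomorphic_scv D f" "\<And>z. z \<in> D' \<Longrightarrow> z + h \<in> D"
  shows holomorphic_scv_translate: "holomorphic_scv D' (\<lambda>z. f (z + h))"
    and grad_apply_translate: "z \<in> D' \<Longrightarrow> grad_apply (\<lambda>z. f (z + h)) z u = grad_apply f (z + h) u"
proof -
  have der: "((\<lambda>z. f (z + h)) has_derivative grad_apply f (z + h)) (at z)" if "z \<in> D'" for z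
    by (rule has_derivative_compose[where g' = "grad_apply f (z + h)" and f' = "\<lambda>u. u"])
      (use assms that in \<open>auto intro!: derivative_eq_intros holomorphic_scv_derivative\<close>)
  show "holomorphic_scv D' (\<lambda>z. f (z + h))"
    unfolding holomorphic_scv_def by (intro ballI exI conjI, erule der, simp add: grad_apply_scale)
  show "z \<in> D' \<Longrightarrow> grad_apply (\<lambda>z. f (z + h)) z u = grad_apply f (z + h) u"
    by (subst grad_apply_eq[OF der]) (simp_all add: grad_apply_scale)
qed

lemma holomorphic_scv_subset: "holomorphic_scv D f \<Longrightarrow> D' \<subseteq> D \<Longrightarrow> holomorphic_scv D' f"
  by (auto simp: holomorphic_scv_def)

lemma cball_subset_ball_inner: "x \<in> ball z (R - s) \<Longrightarrow> cball x s \<subseteq> ball (z :: 'a::metric_space) R"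
proof
  fix y assume "x \<in> ball z (R - s)" "y \<in> cball x s"
  then show "y \<in> ball z R" using dist_triangle[of z y x] by auto
qed

context
  fixes f :: "complex ^ 'n \<Rightarrow> complex" and D z R M and s :: real
  assumes hol: "holomorphic_scv D f" and sub: "ball z R \<subseteq> D"
    and M: "\<And>y. y \<in> ball z R \<Longrightarrow> cmod (f y) \<le> M" and s: "s > 0"
begin

lemma grad_apply_bound:
  assumes "x \<in> ball z (R - s)"
  shows "cmod (grad_apply f x u) \<le> M / s * norm u"
  using cball_subset_ball_inner[OF assms] sub M s
  by (intro Cauchy_inequality_grad[OF hol]) auto

lemma bound_nonneg: "x \<in> ball z (R - s) \<Longrightarrow> 0 \<le> M"
  using cball_subset_ball_inner[of x z R s] M[of x] s norm_ge_zero[of "f x"]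
  by (metis (no_types, opaque_lifting) centre_in_cball order_trans less_imp_le subsetD)

lemma holomorphic_scv_lipschitz:
  assumes "x \<in> ball z (R - s)" "y \<in> ball z (R - s)"
  shows "cmod (f x - f y) \<le> M / s * norm (x - y)"
proof (rule differentiable_bound[OF convex_ball _ _ assms])
  fix w assume w: "w \<in> ball z (R - s)"
  then have "w \<in> D" using cball_subset_ball_inner[OF w] sub s by auto
  then show "(f has_derivative grad_apply f w) (at w within ball z (R - s))"
    using hol holomorphic_scv_derivative has_derivative_at_withinI by blast
  show "onorm (grad_apply f w) \<le> M / s"
    using w s bound_nonneg[OF w] by (intro onorm_bound grad_apply_bound) auto
qed

text \<open>The difference of two values of the derivative is the derivative of a difference of
  translates of \<open>f\<close>, which is small by the Lipschitz estimate for \<open>f\<close> itself.\<close>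

lemma grad_apply_lipschitz:
  assumes "x \<in> ball z (R - 2 * s)" "y \<in> ball z (R - 2 * s)"
  shows "cmod (grad_apply f y u - grad_apply f x u) \<le> M / s * norm (y - x) / s * norm u"
proof -
  define h where "h = y - x"
  define D' where "D' = {w \<in> D. w + h \<in> D}"
  have hol1: "holomorphic_scv D' (\<lambda>w. f (w + h))"
    by (rule holomorphic_scv_translate[OF hol]) (auto simp: D'_def)
  have hol2: "holomorphic_scv D' f"
    by (rule holomorphic_scv_subset[OF hol]) (auto simp: D'_def)
  have near: "w \<in> ball z (R - s)" "w + h \<in> ball z (R - s)" if "w \<in> cball x s" for w
  proof -
    have "cball x s \<subseteq> ball z (R - s)" "cball y s \<subseteq> ball z (R - s)"
      using assms by (auto intro!: cball_subset_ball_inner)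
    moreover have "w + h \<in> cball y s"
      using that by (simp add: h_def dist_norm algebra_simps)
    ultimately show "w \<in> ball z (R - s)" "w + h \<in> ball z (R - s)" using that by blast+
  qed
  have "ball z (R - s) \<subseteq> D" using sub s by auto
  then have sub': "cball x s \<subseteq> D'" using near by (auto simp: D'_def)
  have "cmod (grad_apply (\<lambda>w. f (w + h) - f w) x u) \<le> M / s * norm h / s * norm u"
  proof (rule Cauchy_inequality_grad[OF _ sub' s])
    show "holomorphic_scv D' (\<lambda>w. f (w + h) - f w)"
      by (rule holomorphic_scv_diff[OF hol1 hol2])
    show "cmod (f (w + h) - f w) \<le> M / s * norm h" if "w \<in> cball x s" for w
      using holomorphic_scv_lipschitz[OF near(2)[OF that] near(1)[OF that]] by simp
  qed
  moreover have "x \<in> D'" using sub' s by auto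
  moreover have "grad_apply (\<lambda>w. f (w + h)) x u = grad_apply f y u"
    using grad_apply_translate[OF hol, of D' h x u] \<open>x \<in> D'\<close> by (auto simp: D'_def h_def)
  ultimately show ?thesis
    using grad_apply_diff[OF hol1 hol2, of x u] by (simp add: h_def)
qed

text \<open>Along the segment from \<open>x\<close> to \<open>y\<close> the derivative differs from its value at \<open>x\<close> by at most
  the Lipschitz bound.\<close>

lemma grad_apply_linearization:
  assumes x: "x \<in> ball z (R - 2 * s)" and y: "y \<in> ball z (R - 2 * s)"
  shows "cmod (f y - f x - grad_apply f x (y - x)) \<le> M / s / s * (norm (y - x))\<^sup>2"
proof -
  have "R - 2 * s \<le> R - s" using s by simp
  then have x': "x \<in> ball z (R - s)" using x subset_ball by blast
  have seg: "closed_segment x y \<subseteq> ball z (R - 2 * s)"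
    using x y by (simp add: closed_segment_subset)
  have "norm (f y - f x - grad_apply f x (y - x)) \<le> norm (y - x) * (M / s * norm (y - x) / s)"
  proof (rule differentiable_bound_linearization[of x y "closed_segment x y" f "grad_apply f" x])
    show "x + t *\<^sub>R (y - x) \<in> closed_segment x y" if "t \<in> {0..1}" for t
      using that by (auto simp: closed_segment_def algebra_simps intro!: exI[of _ t])
    fix w assume w: "w \<in> closed_segment x y"
    then have w': "w \<in> ball z (R - 2 * s)" using seg by blast
    then have "w \<in> D" using sub s by (auto simp: subset_iff)
    then show "(f has_derivative grad_apply f w) (at w within closed_segment x y)"
      using hol holomorphic_scv_derivative has_derivative_at_withinI by blast
    have wx: "norm (w - x) \<le> norm (y - x)"
      using w segment_bound(1) by blast
    show "onorm (grad_apply f w - grad_apply f x) \<le> M / s * norm (y - x) / s"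
    proof (rule onorm_bound)
      show "0 \<le> M / s * norm (y - x) / s"
        using bound_nonneg[OF x'] s by simp
      fix u
      have "cmod ((grad_apply f w - grad_apply f x) u) \<le> M / s * norm (w - x) / s * norm u"
        using grad_apply_lipschitz[OF x w'] by simp
      also have "\<dots> \<le> M / s * norm (y - x) / s * norm u"
        using bound_nonneg[OF x'] s wx
        by (intro mult_right_mono divide_right_mono mult_left_mono) auto
      finally show "cmod ((grad_apply f w - grad_apply f x) u) \<le> M / s * norm (y - x) / s * norm u" .
    qed
  qed simp
  then show ?thesis by (simp add: power2_eq_square mult_ac)
qed

end

text \<open>The difference quotients of \<open>f\<close> in direction \<open>v\<close> are holomorphic and, by the quadratic
  estimate for the linearization, converge locally uniformly.\<close>

lemma holomorphic_scv_grad_apply: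
  fixes f :: "complex ^ 'n \<Rightarrow> complex"
  assumes "open D" and hol: "holomorphic_scv D f"
  shows "holomorphic_scv D (\<lambda>x. grad_apply f x v)"
proof -
  have "((\<lambda>x. grad_apply f x v) has_derivative grad_apply (\<lambda>x. grad_apply f x v) z) (at z)" if z: "z \<in> D" for z
  proof -
    obtain R where R: "R > 0" "cball z R \<subseteq> D"
      using \<open>open D\<close> z open_contains_cball by blast
    have "compact (f ` cball z R)"
      by (intro compact_continuous_image continuous_on_subset[OF holomorphic_scv_continuous_on[OF hol]])
        (use R in auto)
    then obtain M where M: "\<And>y. y \<in> cball z R \<Longrightarrow> cmod (f y) \<le> M"
      using compact_imp_bounded[of "f ` cball z R"] unfolding bounded_iff by blast
    have sub: "ball z R \<subseteq> D" using R by auto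
    define s where "s = R / 4"
    have s: "s > 0" and Rs: "R = 4 * s" using R by (auto simp: s_def)
    \<comment> \<open>step lengths tending to 0 and so short that \<open>x + h n *\<^sub>R v\<close> moves by less than \<open>s\<close>\<close>
    define h where "h = (\<lambda>n. s / (norm v + 1) / (real n + 1))"
    have v1: "norm v + 1 > 0" by (simp add: add_nonneg_pos)
    then have h_pos: "h n > 0" for n using s by (simp add: h_def)
    have h_small: "h n * norm v < s" for n
    proof -
      have "h n \<le> s / (norm v + 1)"
        using divide_left_mono[of 1 "real n + 1" "s / (norm v + 1)"] s v1 by (simp add: h_def)
      then have "h n * norm v \<le> s / (norm v + 1) * norm v"
        by (intro mult_right_mono) auto
      also have "\<dots> < s" using v1 s by (simp add: field_simps)
      finally show ?thesis .
    qed
    have shift: "x + h n *\<^sub>R v \<in> ball z (R - 2 * s)" if "x \<in> ball z s" for x n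
    proof -
      have "dist z (x + h n *\<^sub>R v) \<le> dist z x + h n * norm v"
        using dist_triangle[of z "x + h n *\<^sub>R v" x] h_pos[of n] by (simp add: dist_norm)
      then show ?thesis using that h_small[of n] Rs by simp
    qed
    have small: "ball z s \<subseteq> ball z (R - 2 * s)" using s Rs by (intro subset_ball) simp
    define F where "F = (\<lambda>n x. complex_of_real (1 / h n) * (f (x + h n *\<^sub>R v) - f x))"
    have close: "cmod (F n x - grad_apply f x v) \<le> M / s / s * h n * (norm v)\<^sup>2"
      if "x \<in> ball z s" for n x
    proof -
      have "cmod (f (x + h n *\<^sub>R v) - f x - grad_apply f x (x + h n *\<^sub>R v - x))
          \<le> M / s / s * (norm (x + h n *\<^sub>R v - x))\<^sup>2"
      proof (rule grad_apply_linearization[OF hol sub _ s])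
        show "cmod (f y) \<le> M" if "y \<in> ball z R" for y using M that by simp
        show "x \<in> ball z (R - 2 * s)" using small that by blast
      qed (rule shift[OF that])
      then have "cmod (f (x + h n *\<^sub>R v) - f x - h n *\<^sub>R grad_apply f x v)
          \<le> h n * (M / s / s * h n * (norm v)\<^sup>2)"
        by (simp add: grad_apply_scaleR power2_eq_square mult_ac)
      moreover have "f (x + h n *\<^sub>R v) - f x - h n *\<^sub>R grad_apply f x v
          = h n *\<^sub>R (F n x - grad_apply f x v)"
        using h_pos[of n] by (simp add: F_def scaleR_conv_of_real right_diff_distrib)
      ultimately have "h n * cmod (F n x - grad_apply f x v) \<le> h n * (M / s / s * h n * (norm v)\<^sup>2)"
        using h_pos[of n] by simp
      then show ?thesis using h_pos[of n] mult_le_cancel_left_pos by blast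
    qed
    have lim: "(\<lambda>n. M / s / s * h n * (norm v)\<^sup>2) \<longlonglongrightarrow> 0"
    proof -
      have "(\<lambda>n. s / (norm v + 1) * (1 / (real n + 1))) \<longlonglongrightarrow> s / (norm v + 1) * 0"
        using LIMSEQ_inverse_real_of_nat by (intro tendsto_mult) (auto simp: inverse_eq_divide add.commute)
      then have "h \<longlonglongrightarrow> 0" by (simp add: h_def)
      then have "(\<lambda>n. M / s / s * h n * (norm v)\<^sup>2) \<longlonglongrightarrow> M / s / s * 0 * (norm v)\<^sup>2"
        by (intro tendsto_mult tendsto_const)
      then show ?thesis by simp
    qed
    have ul: "uniform_limit (ball z s) F (\<lambda>x. grad_apply f x v) sequentially"
    proof (rule uniform_limitI)
      fix e :: real assume "e > 0"
      with lim have "\<forall>\<^sub>F n in sequentially. M / s / s * h n * (norm v)\<^sup>2 < e"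
        by (rule order_tendstoD)
      then show "\<forall>\<^sub>F n in sequentially. \<forall>x\<in>ball z s. dist (F n x) (grad_apply f x v) < e"
        by eventually_elim (unfold dist_norm, blast intro: le_less_trans close)
    qed
    have holF: "holomorphic_scv (ball z s) (F n)" for n
      unfolding F_def
    proof (rule holomorphic_scv_cmult, rule holomorphic_scv_diff)
      have "ball z (R - 2 * s) \<subseteq> D" using sub s by auto
      then show "holomorphic_scv (ball z s) (\<lambda>x. f (x + h n *\<^sub>R v))" "holomorphic_scv (ball z s) f"
        using shift small
        by (blast intro: holomorphic_scv_translate[OF hol] holomorphic_scv_subset[OF hol])+
    qed
    have "holomorphic_scv (ball z s) (\<lambda>x. grad_apply f x v)"
    proof (rule holomorphic_scv_uniform_limit(1)[OF open_ball holF])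
      fix w assume w: "w \<in> ball z s"
      obtain r where r: "r > 0" "ball w r \<subseteq> ball z s"
        using openE[OF open_ball w] by blast
      show "\<exists>r>0. uniform_limit (ball w r) F (\<lambda>x. grad_apply f x v) sequentially"
        using r(1) uniform_limit_on_subset[OF ul r(2)] by (intro exI[of _ r]) simp
    qed
    then show ?thesis by (rule holomorphic_scv_derivative) (simp add: s)
  qed
  then show ?thesis by (simp add: holomorphic_scv_iff)
qed

section \<open>Point evaluations are bounded in the square mean\<close>

lemma nn_integral_lborel_translate:
  fixes a :: "'a::euclidean_space"
  assumes [measurable]: "g \<in> borel_measurable borel"
  shows "(\<integral>\<^sup>+x. g (a + x) \<partial>lborel) = (\<integral>\<^sup>+x. g x \<partial>lborel)"
proof -
  have "(\<integral>\<^sup>+x. g x \<partial>distr lborel borel ((+) a)) = (\<integral>\<^sup>+x. g (a + x) \<partial>lborel)"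
    by (rule nn_integral_distr) auto
  then show ?thesis by (simp add: lborel_distr_plus)
qed

lemma emeasure_lborel_ball_center:
  "emeasure lborel (ball (a :: 'a::euclidean_space) r) = emeasure lborel (ball 0 r :: 'a set)"
proof (cases "r \<ge> 0")
  case True
  then show ?thesis by (simp add: emeasure_ball)
qed (simp add: ball_empty)

text \<open>Writing \<open>b\<close> for the indicator of the unit
  ball, Tonelli and translation invariance turn \<open>\<integral>\<integral> b y * g (R x + y)\<close> into
  \<open>vol(ball) * \<integral> g (R x)\<close> when \<open>x\<close> is integrated first, and into \<open>vol(ball) * \<integral> g y\<close> when
  \<open>y\<close> is shifted first, because \<open>R\<close> maps balls to balls of the same radius.\<close>

lemma nn_integral_lborel_isometry:
  fixes R S :: "'a::euclidean_space \<Rightarrow> 'a"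
  assumes lin: "linear R" and iso: "\<And>x. norm (R x) = norm x" and RS: "\<And>x. R (S x) = x"
    and [measurable]: "g \<in> borel_measurable borel"
  shows "(\<integral>\<^sup>+x. g (R x) \<partial>lborel) = (\<integral>\<^sup>+x. g x \<partial>lborel)"
proof -
  define b :: "'a \<Rightarrow> ennreal" where "b = indicator (ball 0 1)"
  define V where "V = emeasure lborel (ball 0 1 :: 'a set)"
  have [measurable]: "R \<in> borel_measurable borel"
    by (intro borel_measurable_continuous_onI linear_continuous_on lin[unfolded linear_conv_bounded_linear])
  have [measurable]: "b \<in> borel_measurable borel"
    unfolding b_def by (rule borel_measurable_indicator) simp
  have "(\<integral>\<^sup>+x. g (R x) \<partial>lborel) * V = (\<integral>\<^sup>+y. b y * (\<integral>\<^sup>+x. g (R x) \<partial>lborel) \<partial>lborel)"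
    unfolding b_def V_def by (subst nn_integral_multc) (auto simp: mult.commute intro!: borel_measurable_indicator)
  also have "\<dots> = (\<integral>\<^sup>+y. b y * (\<integral>\<^sup>+x. g (R (S y + x)) \<partial>lborel) \<partial>lborel)"
    by (subst nn_integral_lborel_translate[of "\<lambda>x. g (R x)"]) auto
  also have "\<dots> = (\<integral>\<^sup>+y. (\<integral>\<^sup>+x. b y * g (y + R x) \<partial>lborel) \<partial>lborel)"
    by (simp add: nn_integral_cmult linear_add[OF lin] RS)
  also have "\<dots> = (\<integral>\<^sup>+x. (\<integral>\<^sup>+y. b y * g (y + R x) \<partial>lborel) \<partial>lborel)"
    by (rule lborel_pair.Fubini') measurable
  also have "\<dots> = (\<integral>\<^sup>+x. (\<integral>\<^sup>+y. b (y - R x) * g y \<partial>lborel) \<partial>lborel)"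
  proof (rule nn_integral_cong)
    fix x
    show "(\<integral>\<^sup>+y. b y * g (y + R x) \<partial>lborel) = (\<integral>\<^sup>+y. b (y - R x) * g y \<partial>lborel)"
      using nn_integral_lborel_translate[of "\<lambda>y. b y * g (y + R x)" "- R x"] by simp
  qed
  also have "\<dots> = (\<integral>\<^sup>+y. (\<integral>\<^sup>+x. b (y - R x) * g y \<partial>lborel) \<partial>lborel)"
    by (rule lborel_pair.Fubini') measurable
  also have "\<dots> = (\<integral>\<^sup>+y. V * g y \<partial>lborel)"
  proof (rule nn_integral_cong)
    fix y
    have "norm (y - R x) = dist (S y) x" for x
      using iso[of "S y - x"] by (simp add: linear_diff[OF lin] RS dist_norm)
    then have "b (y - R x) = indicator (ball (S y) 1) x" for x
      by (simp add: b_def indicator_def)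
    then show "(\<integral>\<^sup>+x. b (y - R x) * g y \<partial>lborel) = V * g y"
      by (subst nn_integral_multc)
        (auto simp: V_def emeasure_lborel_ball_center[of "S y"] intro!: borel_measurable_indicator)
  qed
  also have "\<dots> = (\<integral>\<^sup>+x. g x \<partial>lborel) * V"
    by (simp add: nn_integral_cmult mult.commute)
  finally have "V * (\<integral>\<^sup>+x. g (R x) \<partial>lborel) = V * (\<integral>\<^sup>+x. g x \<partial>lborel)"
    by (simp add: mult.commute)
  moreover have "V \<noteq> \<infinity>" "V \<noteq> 0"
    using emeasure_lborel_ball_finite[of "0::'a" 1] unit_ball_vol_pos[of "real DIM('a)"]
    by (auto simp: V_def emeasure_ball simp del: unit_ball_vol_pos)
  ultimately show ?thesis
    by (simp add: ennreal_mult_cancel_left)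
qed

lemma circle_mean_value:
  assumes "g holomorphic_on cball 0 1"
  shows "((\<lambda>t. g (cis (2 * pi * t))) has_integral g 0) {0..1}"
proof -
  have "((\<lambda>u. g u / (u - 0)) has_contour_integral (2 * of_real pi * \<i> * g 0)) (circlepath 0 1)"
    by (rule Cauchy_integral_circlepath_simple[OF assms]) simp
  then have "((\<lambda>t. g (circlepath 0 1 t) / circlepath 0 1 t *
      vector_derivative (circlepath 0 1) (at t within {0..1})) has_integral
      (2 * of_real pi * \<i> * g 0)) {0..1}"
    by (simp add: has_contour_integral_def)
  then have "((\<lambda>t. 2 * of_real pi * \<i> * g (cis (2 * pi * t))) has_integral
      (2 * of_real pi * \<i> * g 0)) {0..1}"
    by (rule has_integral_eq[rotated])
      (subst vector_derivative_circlepath01, auto simp: circlepath cis_conv_exp mult_ac)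
  from has_integral_mult_right[OF this, of "1 / (2 * of_real pi * \<i>)"]
  show ?thesis by simp
qed

text \<open>The mean value property over the unitary circle action \<open>y \<mapsto> e\<^sup>i\<^sup>\<theta> y\<close>, applied to
  the holomorphic function \<open>f\<^sup>2\<close> and then averaged over all \<open>y\<close> in a ball.\<close>

lemma sub_mean_value_square:
  fixes f :: "complex ^ 'n \<Rightarrow> complex"
  assumes hol: "holomorphic_scv D f" and sub: "ball x r \<subseteq> D"
  shows "emeasure lborel (ball 0 r :: (complex ^ 'n) set) * ennreal ((cmod (f x))\<^sup>2)
    \<le> (\<integral>\<^sup>+y. ennreal (indicator (ball x r) y * (cmod (f y))\<^sup>2) \<partial>lborel)"
proof -
  define I :: "real \<Rightarrow> ennreal" where "I = indicator {0..1}"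
  define F where "F = (\<lambda>y. ennreal (indicator (ball 0 r) y *\<^sub>R (cmod (f (x + y)))\<^sup>2))"
  define e where "e = (\<lambda>t. cis (2 * pi * t))"
  have "continuous_on (ball 0 r) (\<lambda>y. (cmod (f (x + y)))\<^sup>2)"
    using sub by (intro continuous_intros
        continuous_on_compose2[OF holomorphic_scv_continuous_on[OF hol]])
      (auto simp: subset_iff dist_norm)
  then have "(\<lambda>y. indicator (ball 0 r) y *\<^sub>R (cmod (f (x + y)))\<^sup>2) \<in> borel_measurable borel"
    by (intro borel_measurable_continuous_on_indicator) auto
  then have [measurable]: "F \<in> borel_measurable borel"
    by (simp add: F_def)
  have "continuous_on UNIV (\<lambda>p. e (fst p) *s (snd p :: complex ^ 'n))"
    unfolding vector_scalar_mult_def e_def cis_conv_exp by (intro continuous_intros)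
  then have [measurable]: "(\<lambda>p. e (fst p) *s (snd p :: complex ^ 'n)) \<in> borel_measurable (borel \<Otimes>\<^sub>M borel)"
    using borel_measurable_continuous_onI by (simp add: borel_prod)
  have meas[measurable]: "(\<lambda>(y, t). I t * F (e t *s y)) \<in> borel_measurable (lborel \<Otimes>\<^sub>M lborel)"
  proof -
    have "(\<lambda>p. e (fst p) *s (snd p :: complex ^ 'n)) \<circ> (\<lambda>(y, t). (t, y))
        \<in> borel_measurable (lborel \<Otimes>\<^sub>M lborel)"
      by (rule measurable_comp[of _ _ "borel \<Otimes>\<^sub>M borel"]) auto
    then have [measurable]: "(\<lambda>(y, t). e t *s (y :: complex ^ 'n))
        \<in> borel_measurable (lborel \<Otimes>\<^sub>M lborel)"
      by (simp add: o_def case_prod_beta)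
    have "(\<lambda>p. I (snd p) * F ((\<lambda>(y, t). e t *s y) p)) \<in> borel_measurable (lborel \<Otimes>\<^sub>M lborel)"
      unfolding I_def by measurable
    then show ?thesis by (simp add: case_prod_beta)
  qed
  have norm_e: "cmod (e t) = 1" for t by (simp add: e_def)
  have mean: "indicator (ball 0 r) y * ennreal ((cmod (f x))\<^sup>2) \<le> (\<integral>\<^sup>+t. I t * F (e t *s y) \<partial>lborel)" for y
  proof (cases "y \<in> ball 0 r")
    case y: True
    have mem: "x + c *s y \<in> D" if "c \<in> cball 0 1" for c :: complex
    proof -
      have "norm (c *s y) \<le> 1 * norm y"
        unfolding norm_cvec_scale using that by (intro mult_right_mono) auto
      then show ?thesis using y sub by (auto simp: subset_iff dist_norm)
    qed
    define g where "g = (\<lambda>c. (f (x + c *s y))\<^sup>2)"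
    have "g holomorphic_on cball 0 1"
      unfolding holomorphic_on_def
    proof
      fix c :: complex assume "c \<in> cball 0 1"
      then have "((\<lambda>c. f (x + c *s y)) has_field_derivative grad_apply f (x + c *s y) y) (at c)"
        using has_field_derivative_complex_line[OF hol mem] by blast
      then have "(\<lambda>c. f (x + c *s y)) field_differentiable (at c within cball 0 1)"
        using field_differentiable_def field_differentiable_at_within by blast
      then show "g field_differentiable (at c within cball 0 1)"
        unfolding g_def power2_eq_square by (intro field_differentiable_mult)
    qed
    then have cont: "continuous_on (cball 0 1) g" and
      int: "((\<lambda>t. g (e t)) has_integral g 0) {0..1}"
      using circle_mean_value holomorphic_on_imp_continuous_on unfolding e_def by auto
    have "continuous_on {0..1} (\<lambda>t. g (e t))"
      by (rule continuous_on_compose2[OF cont]) (auto simp: e_def cis_conv_exp intro!: continuous_intros)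
    then have cont': "continuous_on {0..1} (\<lambda>t. cmod (g (e t)))"
      by (intro continuous_intros)
    have "cmod (g 0) \<le> integral {0..1} (\<lambda>t. cmod (g (e t)))"
      using integral_norm_bound_integral[of "\<lambda>t. g (e t)" "{0..1}" "\<lambda>t. cmod (g (e t))"]
        int cont' by (auto simp: has_integral_iff integrable_continuous_interval)
    also have "\<dots> = (LINT t:{0..1}|lborel. cmod (g (e t)))"
      using cont' by (intro set_borel_integral_eq_integral(2)[symmetric] borel_integrable_atLeastAtMost')
    finally have "ennreal (cmod (g 0)) \<le> ennreal (LINT t:{0..1}|lborel. cmod (g (e t)))"
      by (rule ennreal_leI)
    also have "\<dots> = (\<integral>\<^sup>+t. ennreal (indicator {0..1} t *\<^sub>R cmod (g (e t))) \<partial>lborel)"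
      unfolding set_lebesgue_integral_def
      by (rule nn_integral_eq_integral[symmetric])
        (use borel_integrable_atLeastAtMost'[OF cont'] in \<open>auto simp: set_integrable_def\<close>)
    also have "\<dots> = (\<integral>\<^sup>+t. I t * F (e t *s y) \<partial>lborel)"
      using y by (intro nn_integral_cong)
        (auto simp: I_def F_def g_def norm_cvec_scale norm_e norm_power indicator_def)
    finally show ?thesis using y by (simp add: g_def norm_power)
  qed simp
  have "emeasure lborel (ball 0 r :: (complex ^ 'n) set) * ennreal ((cmod (f x))\<^sup>2)
      = (\<integral>\<^sup>+y. indicator (ball 0 r :: (complex ^ 'n) set) y * ennreal ((cmod (f x))\<^sup>2) \<partial>lborel)"
    by (subst nn_integral_multc) (auto intro!: borel_measurable_indicator)
  also have "\<dots> \<le> (\<integral>\<^sup>+y. (\<integral>\<^sup>+t. I t * F (e t *s y) \<partial>lborel) \<partial>lborel)"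
    by (intro nn_integral_mono mean)
  also have "\<dots> = (\<integral>\<^sup>+t. (\<integral>\<^sup>+y. I t * F (e t *s y) \<partial>lborel) \<partial>lborel)"
    by (rule lborel_pair.Fubini'[symmetric]) (use meas in \<open>simp add: measurable_split_conv\<close>)
  also have "\<dots> = (\<integral>\<^sup>+t. I t * (\<integral>\<^sup>+y. F y \<partial>lborel) \<partial>lborel)"
  proof (rule nn_integral_cong)
    fix t
    have lin: "linear (\<lambda>y :: complex ^ 'n. e t *s y)"
      by (rule linearI) (auto simp: vec_eq_iff algebra_simps)
    have [measurable]: "(\<lambda>y :: complex ^ 'n. e t *s y) \<in> borel_measurable borel"
      by (intro borel_measurable_continuous_onI linear_continuous_on lin[unfolded linear_conv_bounded_linear])
    have "e t * inverse (e t) = 1"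
      using norm_e[of t] by (intro right_inverse) auto
    then have "(\<integral>\<^sup>+y. F (e t *s y) \<partial>lborel) = (\<integral>\<^sup>+y. F y \<partial>lborel)"
      by (intro nn_integral_lborel_isometry[where S = "\<lambda>y. inverse (e t) *s y"] lin)
        (auto simp: norm_cvec_scale norm_e vector_smult_assoc)
    then show "(\<integral>\<^sup>+y. I t * F (e t *s y) \<partial>lborel) = I t * (\<integral>\<^sup>+y. F y \<partial>lborel)"
      by (simp add: nn_integral_cmult)
  qed
  also have "\<dots> = (\<integral>\<^sup>+y. F y \<partial>lborel)"
    by (simp add: nn_integral_multc I_def)
  also have "\<dots> = (\<integral>\<^sup>+y. F (- x + y) \<partial>lborel)"
    by (rule nn_integral_lborel_translate[symmetric]) simp
  also have "\<dots> = (\<integral>\<^sup>+y. ennreal (indicator (ball x r) y * (cmod (f y))\<^sup>2) \<partial>lborel)"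
    by (intro nn_integral_cong) (auto simp: F_def indicator_def dist_norm norm_minus_commute)
  finally show ?thesis .
qed

section \<open>The Bergman space as a Hilbert space\<close>

locale bounded_open_set =
  fixes D :: "(complex ^ 'n) set"
  assumes open_D: "open D" and bounded_D: "bounded D"
begin

definition ip :: "(complex ^ 'n \<Rightarrow> complex) \<Rightarrow> (complex ^ 'n \<Rightarrow> complex) \<Rightarrow> complex" where
  "ip f g = (LINT x:D|lborel. f x * cnj (g x))"

definition norm_sq :: "(complex ^ 'n \<Rightarrow> complex) \<Rightarrow> real" where
  "norm_sq f = (LINT x:D|lborel. (cmod (f x))\<^sup>2)"

abbreviation A2 :: "(complex ^ 'n \<Rightarrow> complex) set" where "A2 \<equiv> bergman_space D"

abbreviation L2norm :: "(complex ^ 'n \<Rightarrow> complex) \<Rightarrow> real" where "L2norm f \<equiv> sqrt (norm_sq f)"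

lemma D_borel [measurable]: "D \<in> sets borel"
  using open_D by simp

lemma A2_holomorphic: "f \<in> A2 \<Longrightarrow> holomorphic_scv D f"
  by (simp add: bergman_space_def)

lemma A2_square_integrable: "f \<in> A2 \<Longrightarrow> set_integrable lborel D (\<lambda>x. (cmod (f x))\<^sup>2)"
  by (simp add: bergman_space_def)

lemma continuous_set_borel_measurable:
  "continuous_on D (f :: _ \<Rightarrow> 'b::real_normed_vector) \<Longrightarrow> set_borel_measurable lborel D f"
  using borel_measurable_continuous_on_indicator[of D f] by (simp add: set_borel_measurable_def)

lemma A2_I:
  assumes "holomorphic_scv D f" "set_integrable lborel D g" "\<And>x. x \<in> D \<Longrightarrow> (cmod (f x))\<^sup>2 \<le> g x"
  shows "f \<in> A2"
proof -
  have "set_integrable lborel D (\<lambda>x. (cmod (f x))\<^sup>2)"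
    using assms(2)
  proof (rule set_integrable_bound)
    show "set_borel_measurable lborel D (\<lambda>x. (cmod (f x))\<^sup>2)"
      by (intro continuous_set_borel_measurable continuous_intros
          holomorphic_scv_continuous_on assms)
    show "AE x in lborel. x \<in> D \<longrightarrow> norm ((cmod (f x))\<^sup>2) \<le> norm (g x)"
      using assms(3) by (intro AE_I2) (auto intro: order_trans[OF _ abs_ge_self])
  qed
  then show ?thesis using assms(1) by (simp add: bergman_space_def)
qed

lemma A2_prod_integrable:
  assumes "f \<in> A2" "g \<in> A2"
  shows "set_integrable lborel D (\<lambda>x. f x * cnj (g x))"
proof (rule set_integrable_bound)
  show "set_integrable lborel D (\<lambda>x. (cmod (f x))\<^sup>2 + (cmod (g x))\<^sup>2)"
    by (intro set_integral_add A2_square_integrable assms)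
  show "set_borel_measurable lborel D (\<lambda>x. f x * cnj (g x))"
    by (intro continuous_set_borel_measurable continuous_intros
        holomorphic_scv_continuous_on A2_holomorphic assms)
  have "cmod a * cmod b \<le> (cmod a)\<^sup>2 + (cmod b)\<^sup>2" for a b
    using sum_squares_bound[of "cmod a" "cmod b"]
      mult_nonneg_nonneg[OF norm_ge_zero[of a] norm_ge_zero[of b]] by (simp only: mult.assoc)
  then show "AE x in lborel. x \<in> D \<longrightarrow>
      norm (f x * cnj (g x)) \<le> norm ((cmod (f x))\<^sup>2 + (cmod (g x))\<^sup>2)"
    by (intro AE_I2) (simp add: norm_mult)
qed

lemma A2_const: "(\<lambda>x. c) \<in> A2"
proof -
  have "emeasure lborel D < \<infinity>"
    using bounded_D by (rule emeasure_bounded_finite)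
  then have "set_integrable lborel D (\<lambda>x. (cmod c)\<^sup>2)"
    by (simp add: set_integrable_def)
  then show ?thesis by (rule A2_I[OF holomorphic_scv_const]) simp
qed

lemma A2_add:
  assumes "f \<in> A2" "g \<in> A2"
  shows "(\<lambda>x. f x + g x) \<in> A2"
proof (rule A2_I)
  show "holomorphic_scv D (\<lambda>x. f x + g x)"
    using assms by (intro holomorphic_scv_add A2_holomorphic)
  show "set_integrable lborel D (\<lambda>x. 2 * (cmod (f x))\<^sup>2 + 2 * (cmod (g x))\<^sup>2)"
    using assms by (intro set_integral_add set_integrable_mult_right A2_square_integrable)
  fix x
  have "(cmod (f x + g x))\<^sup>2 \<le> (cmod (f x) + cmod (g x))\<^sup>2"
    by (intro power_mono norm_triangle_ineq) simp
  also have "\<dots> \<le> 2 * (cmod (f x))\<^sup>2 + 2 * (cmod (g x))\<^sup>2"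
    using sum_squares_bound[of "cmod (f x)" "cmod (g x)"] by (simp add: power2_sum)
  finally show "(cmod (f x + g x))\<^sup>2 \<le> 2 * (cmod (f x))\<^sup>2 + 2 * (cmod (g x))\<^sup>2" .
qed

lemma A2_bounded_mult:
  assumes "f \<in> A2" "holomorphic_scv D h" "\<And>x. x \<in> D \<Longrightarrow> cmod (h x) \<le> B"
  shows "(\<lambda>x. h x * f x) \<in> A2" and "norm_sq (\<lambda>x. h x * f x) \<le> B\<^sup>2 * norm_sq f"
proof -
  have le: "(cmod (h x * f x))\<^sup>2 \<le> B\<^sup>2 * (cmod (f x))\<^sup>2" if "x \<in> D" for x
    using assms(3)[OF that] by (auto simp: norm_mult power_mult_distrib intro!: mult_right_mono power_mono)
  have int: "set_integrable lborel D (\<lambda>x. B\<^sup>2 * (cmod (f x))\<^sup>2)"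
    using assms by (intro set_integrable_mult_right A2_square_integrable)
  show A: "(\<lambda>x. h x * f x) \<in> A2"
    by (rule A2_I[OF _ int le]) (use assms in \<open>auto intro: holomorphic_scv_mult A2_holomorphic\<close>)
  have "norm_sq (\<lambda>x. h x * f x) \<le> (LINT x:D|lborel. B\<^sup>2 * (cmod (f x))\<^sup>2)"
    unfolding norm_sq_def by (rule set_integral_mono[OF A2_square_integrable[OF A] int le])
  then show "norm_sq (\<lambda>x. h x * f x) \<le> B\<^sup>2 * norm_sq f"
    by (simp add: norm_sq_def)
qed

lemma A2_cmult: "f \<in> A2 \<Longrightarrow> (\<lambda>x. c * f x) \<in> A2"
  using A2_bounded_mult(1)[OF _ holomorphic_scv_const, of f c "cmod c"] by simp

lemma A2_diff: "f \<in> A2 \<Longrightarrow> g \<in> A2 \<Longrightarrow> (\<lambda>x. f x - g x) \<in> A2"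
  using A2_add[OF _ A2_cmult[of g "-1"], of f] by simp

lemmas A2_intros = A2_const A2_add A2_cmult A2_diff

lemma ip_add_left: "f \<in> A2 \<Longrightarrow> g \<in> A2 \<Longrightarrow> h \<in> A2 \<Longrightarrow> ip (\<lambda>x. f x + g x) h = ip f h + ip g h"
  unfolding ip_def by (simp add: distrib_right set_integral_add A2_prod_integrable)

lemma ip_diff_left: "f \<in> A2 \<Longrightarrow> g \<in> A2 \<Longrightarrow> h \<in> A2 \<Longrightarrow> ip (\<lambda>x. f x - g x) h = ip f h - ip g h"
  unfolding ip_def by (simp add: left_diff_distrib set_integral_diff A2_prod_integrable)

lemma ip_cmult_left: "ip (\<lambda>x. c * f x) g = c * ip f g"
  unfolding ip_def by (simp add: mult.assoc)

lemma ip_commute: "ip g f = cnj (ip f g)"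
proof -
  have "cnj (ip f g) = (LINT x:D|lborel. cnj (f x * cnj (g x)))"
    unfolding ip_def set_lebesgue_integral_def Bochner_Integration.integral_cnj[symmetric]
    by (intro Bochner_Integration.integral_cong) (auto simp: indicator_def)
  then show ?thesis by (simp add: ip_def mult.commute)
qed

lemma ip_add_right: "f \<in> A2 \<Longrightarrow> g \<in> A2 \<Longrightarrow> h \<in> A2 \<Longrightarrow> ip h (\<lambda>x. f x + g x) = ip h f + ip h g"
  by (subst (1 2 3) ip_commute) (simp add: ip_add_left)

lemma ip_diff_right: "f \<in> A2 \<Longrightarrow> g \<in> A2 \<Longrightarrow> h \<in> A2 \<Longrightarrow> ip h (\<lambda>x. f x - g x) = ip h f - ip h g"
  by (subst (1 2 3) ip_commute) (simp add: ip_diff_left)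

lemma ip_cmult_right: "ip f (\<lambda>x. c * g x) = cnj c * ip f g"
  by (subst (1 2) ip_commute) (simp add: ip_cmult_left)

lemma ip_self: "ip f f = complex_of_real (norm_sq f)"
  unfolding ip_def norm_sq_def
  by (simp add: complex_norm_square[symmetric] set_lebesgue_integral_def flip: of_real_mult
      scaleR_conv_of_real) (simp add: scaleR_conv_of_real flip: integral_complex_of_real)

lemma norm_sq_nonneg: "norm_sq f \<ge> 0"
  unfolding norm_sq_def set_lebesgue_integral_def by (rule integral_nonneg_AE) simp

lemma norm_sq_diff_cmult:
  assumes "f \<in> A2" "g \<in> A2"
  shows "norm_sq (\<lambda>x. f x - c * g x) = norm_sq f - 2 * Re (cnj c * ip f g) + (cmod c)\<^sup>2 * norm_sq g"
proof -
  have "complex_of_real (norm_sq (\<lambda>x. f x - c * g x)) =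
      ip f f - (cnj c * ip f g + c * ip g f) + c * cnj c * ip g g"
    unfolding ip_self[symmetric] using assms
    by (simp add: ip_diff_left ip_diff_right ip_cmult_left ip_cmult_right A2_intros algebra_simps)
  also have "cnj c * ip f g + c * ip g f = cnj c * ip f g + cnj (cnj c * ip f g)"
    by (subst (2) ip_commute) simp
  also have "\<dots> = complex_of_real (2 * Re (cnj c * ip f g))"
    by (rule complex_add_cnj)
  also have "c * cnj c = complex_of_real ((cmod c)\<^sup>2)"
    by (simp only: complex_norm_square)
  finally show ?thesis
    unfolding ip_self of_real_mult[symmetric] of_real_add[symmetric] of_real_diff[symmetric]
    by (simp only: of_real_eq_iff)
qed

text \<open>First-order optimality, used for the minimizer in the Riesz representation and for the
  degenerate case of the Cauchy--Schwarz inequality.\<close>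

lemma orthogonal_if_minimal:
  assumes "f \<in> A2" "g \<in> A2" and min: "\<And>c. norm_sq (\<lambda>x. f x - c * g x) \<ge> norm_sq f"
  shows "ip f g = 0"
proof (rule ccontr)
  define p where "p = ip f g"
  define b where "b = norm_sq g"
  assume "ip f g \<noteq> 0"
  then have p: "(cmod p)\<^sup>2 > 0" by (simp add: p_def)
  have b: "b \<ge> 0" by (simp add: b_def norm_sq_nonneg)
  \<comment> \<open>moving from \<open>f\<close> by a small multiple of \<open>p g\<close> decreases the norm to first order\<close>
  define t where "t = 1 / (b + 1)"
  have t: "t > 0" "t * b < 1" using b by (auto simp: t_def)
  have "norm_sq f - 2 * (t * (cmod p)\<^sup>2) + (t * cmod p)\<^sup>2 * b \<ge> norm_sq f"
    using min[of "t * p"] norm_sq_diff_cmult[OF assms(1,2), of "t * p"] t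
    by (simp add: p_def b_def norm_mult complex_norm_square[symmetric] mult.assoc
        mult.commute[of "cnj (ip f g)"] flip: of_real_mult)
  then have "t * (cmod p)\<^sup>2 * (2 - t * b) \<le> 0"
    by (simp add: power2_eq_square algebra_simps)
  moreover have "t * (cmod p)\<^sup>2 * (2 - t * b) > 0"
    using t p by (intro mult_pos_pos) auto
  ultimately show False by simp
qed

lemma Cauchy_Schwarz_sq:
  assumes "f \<in> A2" "g \<in> A2"
  shows "(cmod (ip f g))\<^sup>2 \<le> norm_sq f * norm_sq g"
proof (cases "norm_sq g = 0")
  case True
  have "ip g f = 0"
    by (rule orthogonal_if_minimal[OF assms(2,1)]) (simp add: True norm_sq_nonneg)
  then show ?thesis by (subst ip_commute) (simp add: True)
next
  case False
  define b where "b = norm_sq g"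
  have b: "b > 0" using False norm_sq_nonneg[of g] by (simp add: b_def)
  define p where "p = ip f g"
  have "0 \<le> norm_sq (\<lambda>x. f x - (p / b) * g x)" by (rule norm_sq_nonneg)
  also have "\<dots> = norm_sq f - 2 * Re (cnj (p / b) * p) + (cmod (p / b))\<^sup>2 * b"
    by (simp only: norm_sq_diff_cmult[OF assms] p_def b_def)
  also have "cnj (p / b) * p = complex_of_real ((cmod p)\<^sup>2 / b)"
    using complex_norm_square[of p] by (simp add: mult.commute)
  also have "(cmod (p / b))\<^sup>2 * b = (cmod p)\<^sup>2 / b"
    using b by (simp add: norm_divide power_divide power2_eq_square)
  also have "norm_sq f - 2 * Re (complex_of_real ((cmod p)\<^sup>2 / b)) + (cmod p)\<^sup>2 / b
      = norm_sq f - (cmod p)\<^sup>2 / b"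
    by simp
  finally show ?thesis using b by (simp add: p_def b_def field_simps)
qed

lemma Cauchy_Schwarz: "f \<in> A2 \<Longrightarrow> g \<in> A2 \<Longrightarrow> cmod (ip f g) \<le> L2norm f * L2norm g"
  using Cauchy_Schwarz_sq[of f g] by (simp add: real_le_rsqrt flip: real_sqrt_mult)

lemma L2norm_triangle:
  assumes "f \<in> A2" "g \<in> A2"
  shows "L2norm (\<lambda>x. f x - g x) \<le> L2norm f + L2norm g"
proof (rule power2_le_imp_le)
  have "norm_sq (\<lambda>x. f x - g x) = norm_sq f - 2 * Re (ip f g) + norm_sq g"
    using norm_sq_diff_cmult[OF assms, of 1] by simp
  also have "- Re (ip f g) \<le> L2norm f * L2norm g"
    using Cauchy_Schwarz[OF assms] abs_Re_le_cmod[of "ip f g"] by linarith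
  then have "norm_sq f - 2 * Re (ip f g) + norm_sq g \<le> (L2norm f + L2norm g)\<^sup>2"
    by (simp add: power2_sum norm_sq_nonneg)
  finally show "(L2norm (\<lambda>x. f x - g x))\<^sup>2 \<le> (L2norm f + L2norm g)\<^sup>2"
    by (simp add: norm_sq_nonneg)
qed (simp add: norm_sq_nonneg)

definition ball_vol :: "real \<Rightarrow> real" where
  "ball_vol R = measure lborel (ball (0 :: complex ^ 'n) R)"

lemma ball_vol_pos: "R > 0 \<Longrightarrow> ball_vol R > 0"
  by (simp add: ball_vol_def content_ball_pos)

text \<open>The sub-mean value inequality on the ball of radius \<open>R\<close> around \<open>x\<close>, which stays in \<open>D\<close>.\<close>

lemma evaluation_bound:
  assumes "R > 0" "ball z (2 * R) \<subseteq> D" "x \<in> ball z R" "f \<in> A2"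
  shows "cmod (f x) \<le> L2norm f / sqrt (ball_vol R)"
proof -
  have sub: "ball x R \<subseteq> D"
  proof
    fix y assume "y \<in> ball x R"
    then have "y \<in> ball z (2 * R)" using assms(3) dist_triangle[of z y x] by auto
    then show "y \<in> D" using assms by blast
  qed
  have "ennreal (ball_vol R * (cmod (f x))\<^sup>2)
      = emeasure lborel (ball (0 :: complex ^ 'n) R) * ennreal ((cmod (f x))\<^sup>2)"
    using emeasure_lborel_ball_finite[of "0 :: complex ^ 'n" R]
    by (subst ennreal_mult) (auto simp: ball_vol_def emeasure_eq_ennreal_measure less_top)
  also have "\<dots> \<le> (\<integral>\<^sup>+y. ennreal (indicator (ball x R) y * (cmod (f y))\<^sup>2) \<partial>lborel)"
    by (rule sub_mean_value_square[OF A2_holomorphic[OF assms(4)] sub])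
  also have "\<dots> \<le> (\<integral>\<^sup>+y. ennreal (indicator D y *\<^sub>R (cmod (f y))\<^sup>2) \<partial>lborel)"
    using sub by (intro nn_integral_mono) (auto simp: indicator_def)
  also have "\<dots> = ennreal (norm_sq f)"
    unfolding norm_sq_def set_lebesgue_integral_def
    using A2_square_integrable[OF assms(4)]
    by (intro nn_integral_eq_integral) (auto simp: set_integrable_def)
  finally have "ball_vol R * (cmod (f x))\<^sup>2 \<le> norm_sq f"
    by (simp add: norm_sq_nonneg)
  then have "(cmod (f x))\<^sup>2 \<le> (L2norm f / sqrt (ball_vol R))\<^sup>2"
    using ball_vol_pos[OF assms(1)] by (simp add: power_divide norm_sq_nonneg field_simps)
  then show ?thesis
    by (rule power2_le_imp_le) (use ball_vol_pos[OF assms(1)] in \<open>simp add: norm_sq_nonneg\<close>)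
qed

lemma double_ball_inside:
  assumes "z \<in> D"
  obtains R where "R > 0" "ball z (2 * R) \<subseteq> D"
proof -
  obtain r where "r > 0" "ball z r \<subseteq> D" using openE[OF open_D assms] by blast
  then show ?thesis using that[of "r / 2"] by simp
qed

lemma square_measurable:
  assumes "holomorphic_scv D g"
  shows "(\<lambda>x. indicator D x *\<^sub>R (cmod (g x))\<^sup>2) \<in> borel_measurable lborel"
  unfolding set_borel_measurable_def[symmetric]
  by (intro continuous_set_borel_measurable continuous_intros holomorphic_scv_continuous_on assms)

text \<open>Point evaluations turn convergence in square mean into locally uniform convergence, so the
  limit is holomorphic; Fatou's lemma shows that it is also the limit in square mean.\<close>

lemma A2_complete:
  assumes F: "\<And>n. F n \<in> A2"
    and cauchy: "\<And>e. e > 0 \<Longrightarrow> \<exists>N. \<forall>m\<ge>N. \<forall>n\<ge>N. norm_sq (\<lambda>x. F m x - F n x) \<le> e"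
  obtains f where "f \<in> A2" "(\<lambda>n. norm_sq (\<lambda>x. F n x - f x)) \<longlonglongrightarrow> 0"
proof -
  define f where "f = (\<lambda>x. lim (\<lambda>n. F n x))"
  have unif: "\<exists>r>0. uniform_limit (ball z r) F f sequentially" if z: "z \<in> D" for z
  proof -
    obtain R where R: "R > 0" "ball z (2 * R) \<subseteq> D" using double_ball_inside[OF z] .
    define V where "V = sqrt (ball_vol R)"
    have V: "V > 0" using ball_vol_pos[OF R(1)] by (simp add: V_def)
    have "uniformly_Cauchy_on (ball z R) F"
    proof (rule uniformly_Cauchy_onI)
      fix e :: real assume e: "e > 0"
      then have "(V * (e / 2))\<^sup>2 > 0" using V by simp
      from cauchy[OF this] obtain N where
        N: "\<forall>m\<ge>N. \<forall>n\<ge>N. norm_sq (\<lambda>x. F m x - F n x) \<le> (V * (e / 2))\<^sup>2" ..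
      have "dist (F m x) (F n x) < e" if "x \<in> ball z R" "m \<ge> N" "n \<ge> N" for x m n
      proof -
        have "cmod (F m x - F n x) \<le> L2norm (\<lambda>x. F m x - F n x) / V"
          unfolding V_def using evaluation_bound[OF R that(1) A2_diff[OF F F]] .
        also have "\<dots> \<le> sqrt ((V * (e / 2))\<^sup>2) / V"
          using N that V by (intro divide_right_mono real_sqrt_le_mono) auto
        also have "\<dots> = e / 2"
          unfolding real_sqrt_abs using V e by simp
        finally show ?thesis using e by (simp add: dist_norm)
      qed
      then show "\<exists>M. \<forall>x\<in>ball z R. \<forall>m\<ge>M. \<forall>n\<ge>M. dist (F m x) (F n x) < e" by blast
    qed
    then have "uniformly_convergent_on (ball z R) F" by (rule Cauchy_uniformly_convergent)
    then have "uniform_limit (ball z R) F f sequentially"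
      unfolding f_def by (rule uniformly_convergent_uniform_limit_iff[THEN iffD1])
    then show ?thesis using R(1) by blast
  qed
  have lim: "(\<lambda>n. F n x) \<longlonglongrightarrow> f x" if x: "x \<in> D" for x
  proof -
    obtain r where r: "r > 0" "uniform_limit (ball x r) F f sequentially" using unif[OF x] by blast
    show ?thesis by (rule tendsto_uniform_limitI[OF r(2)]) (simp add: r(1))
  qed
  have holf: "holomorphic_scv D f"
    using holomorphic_scv_uniform_limit(1)[OF open_D A2_holomorphic[OF F] unif] .
  have bound: "(\<integral>\<^sup>+x. ennreal (indicator D x *\<^sub>R (cmod (F n x - f x))\<^sup>2) \<partial>lborel) \<le> ennreal e"
    if N: "\<forall>m\<ge>N. \<forall>n\<ge>N. norm_sq (\<lambda>x. F m x - F n x) \<le> e" and "n \<ge> N" for N n e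
  proof -
    define u where "u = (\<lambda>m x. ennreal (indicator D x *\<^sub>R (cmod (F n x - F m x))\<^sup>2))"
    have meas: "u m \<in> borel_measurable lborel" for m
    proof -
      have "(\<lambda>x. indicator D x *\<^sub>R (cmod (F n x - F m x))\<^sup>2) \<in> borel_measurable lborel"
        by (intro square_measurable holomorphic_scv_diff A2_holomorphic F)
      then show ?thesis unfolding u_def by measurable
    qed
    have "ennreal (indicator D x *\<^sub>R (cmod (F n x - f x))\<^sup>2) = liminf (\<lambda>m. u m x)" for x
    proof (cases "x \<in> D")
      case True
      have "(\<lambda>m. u m x) \<longlonglongrightarrow> ennreal (indicator D x *\<^sub>R (cmod (F n x - f x))\<^sup>2)"
        unfolding u_def by (intro tendsto_intros tendsto_ennrealI lim[OF True])
      then show ?thesis by (intro lim_imp_Liminf[symmetric]) auto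
    next
      case False
      then show ?thesis by (simp add: u_def Liminf_const)
    qed
    then have "(\<integral>\<^sup>+x. ennreal (indicator D x *\<^sub>R (cmod (F n x - f x))\<^sup>2) \<partial>lborel)
        \<le> liminf (\<lambda>m. \<integral>\<^sup>+x. u m x \<partial>lborel)"
      using nn_integral_liminf[of u lborel] meas by simp
    also have "\<dots> = liminf (\<lambda>m. ennreal (norm_sq (\<lambda>x. F n x - F m x)))"
    proof -
      have "(\<integral>\<^sup>+x. u m x \<partial>lborel) = ennreal (norm_sq (\<lambda>x. F n x - F m x))" for m
        unfolding norm_sq_def set_lebesgue_integral_def u_def
        using A2_square_integrable[OF A2_diff[OF F F, of n m]]
        by (intro nn_integral_eq_integral) (auto simp: set_integrable_def)
      then show ?thesis by simp
    qed
    also have "\<dots> \<le> ennreal e"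
    proof (rule Liminf_le[THEN order_trans])
      show "\<forall>\<^sub>F m in sequentially. ennreal (norm_sq (\<lambda>x. F n x - F m x)) \<le> ennreal e"
        unfolding eventually_sequentially using N \<open>n \<ge> N\<close> by (intro exI[of _ N]) (auto intro: ennreal_leI)
    qed auto
    finally show ?thesis .
  qed
  have diff: "(\<lambda>x. F n x - f x) \<in> A2"
    if N: "\<forall>m\<ge>N. \<forall>n\<ge>N. norm_sq (\<lambda>x. F m x - F n x) \<le> e" and n: "n \<ge> N" for N n e
  proof -
    have hol: "holomorphic_scv D (\<lambda>x. F n x - f x)"
      by (intro holomorphic_scv_diff A2_holomorphic F holf)
    have "integrable lborel (\<lambda>x. indicator D x *\<^sub>R (cmod (F n x - f x))\<^sup>2)"
    proof (rule integrableI_nonneg)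
      show "(\<lambda>x. indicator D x *\<^sub>R (cmod (F n x - f x))\<^sup>2) \<in> borel_measurable lborel"
        by (rule square_measurable[OF hol])
      show "(\<integral>\<^sup>+x. ennreal (indicator D x *\<^sub>R (cmod (F n x - f x))\<^sup>2) \<partial>lborel) < \<infinity>"
        using bound[OF N n] by (rule order_le_less_trans) simp
    qed simp
    then show ?thesis using hol by (simp add: bergman_space_def set_integrable_def)
  qed
  have small: "norm_sq (\<lambda>x. F n x - f x) \<le> e"
    if N: "\<forall>m\<ge>N. \<forall>n\<ge>N. norm_sq (\<lambda>x. F m x - F n x) \<le> e" and n: "n \<ge> N" and "e > 0" for N n e
  proof -
    have "ennreal (norm_sq (\<lambda>x. F n x - f x))
        = (\<integral>\<^sup>+x. ennreal (indicator D x *\<^sub>R (cmod (F n x - f x))\<^sup>2) \<partial>lborel)"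
      unfolding norm_sq_def set_lebesgue_integral_def
      using A2_square_integrable[OF diff[OF N n]]
      by (intro nn_integral_eq_integral[symmetric]) (auto simp: set_integrable_def)
    also have "\<dots> \<le> ennreal e" by (rule bound[OF N n])
    finally show ?thesis using \<open>e > 0\<close> by simp
  qed
  obtain N where N: "\<forall>m\<ge>N. \<forall>n\<ge>N. norm_sq (\<lambda>x. F m x - F n x) \<le> 1"
    using cauchy[of 1] by auto
  have "(\<lambda>x. F N x - (F N x - f x)) \<in> A2"
    by (intro A2_diff F diff[OF N]) simp
  then have "f \<in> A2" by simp
  moreover have "(\<lambda>n. norm_sq (\<lambda>x. F n x - f x)) \<longlonglongrightarrow> 0"
  proof (rule LIMSEQ_I)
    fix e :: real assume e: "e > 0"
    then obtain N where N: "\<forall>m\<ge>N. \<forall>n\<ge>N. norm_sq (\<lambda>x. F m x - F n x) \<le> e / 2"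
      using cauchy[of "e / 2"] by auto
    have "norm (norm_sq (\<lambda>x. F n x - f x) - 0) < e" if "n \<ge> N" for n
      using small[OF N that] e norm_sq_nonneg[of "\<lambda>x. F n x - f x"] by simp
    then show "\<exists>N. \<forall>n\<ge>N. norm (norm_sq (\<lambda>x. F n x - f x) - 0) < e" by blast
  qed
  ultimately show ?thesis by (rule that)
qed

lemma parallelogram:
  assumes "f \<in> A2" "g \<in> A2"
  shows "norm_sq (\<lambda>x. f x - g x) + norm_sq (\<lambda>x. f x + g x) = 2 * norm_sq f + 2 * norm_sq g"
  using norm_sq_diff_cmult[OF assms, of 1] norm_sq_diff_cmult[OF assms, of "-1"] by simp

lemma norm_sq_cmult: "norm_sq (\<lambda>x. c * f x) = (cmod c)\<^sup>2 * norm_sq f"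
  by (simp add: norm_sq_def norm_mult power_mult_distrib)

text \<open>The representing function is a multiple of the element of least norm in the affine
  hyperplane where the functional takes the value 1.\<close>

lemma riesz_representation:
  assumes lin: "\<And>f g c. f \<in> A2 \<Longrightarrow> g \<in> A2 \<Longrightarrow> \<Lambda> (\<lambda>x. f x - c * g x) = \<Lambda> f - c * \<Lambda> g"
    and bnd: "\<And>f. f \<in> A2 \<Longrightarrow> cmod (\<Lambda> f) \<le> C * L2norm f"
  shows "\<exists>k\<in>A2. \<forall>f\<in>A2. \<Lambda> f = ip f k"
proof (cases "\<forall>f\<in>A2. \<Lambda> f = 0")
  case True
  then show ?thesis
    using ip_cmult_right[of _ 0] by (intro bexI[of _ "\<lambda>x. 0"]) (auto simp: A2_const)
next
  case False
  then obtain g0 where g0: "g0 \<in> A2" "\<Lambda> g0 \<noteq> 0" by blast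
  have zero: "\<Lambda> (\<lambda>x. 0) = 0" using lin[OF g0(1) g0(1), of 1] by simp
  have scale: "\<Lambda> (\<lambda>x. c * f x) = c * \<Lambda> f" if "f \<in> A2" for c f
    using lin[OF A2_const[of 0] that, of "- c"] zero by simp
  have add: "\<Lambda> (\<lambda>x. f x + g x) = \<Lambda> f + \<Lambda> g" if "f \<in> A2" "g \<in> A2" for f g
    using lin[OF that, of "-1"] by simp
  define S where "S = {f \<in> A2. \<Lambda> f = 1}"
  define d where "d = Inf (norm_sq ` S)"
  have "(\<lambda>x. (1 / \<Lambda> g0) * g0 x) \<in> S"
    using g0 scale[OF g0(1), of "1 / \<Lambda> g0"] A2_cmult[OF g0(1), of "1 / \<Lambda> g0"] by (simp add: S_def)
  then have S_ne: "norm_sq ` S \<noteq> {}" by blast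
  have S_bdd: "bdd_below (norm_sq ` S)"
    by (rule bdd_belowI[of _ 0]) (auto simp: norm_sq_nonneg)
  have d_le: "d \<le> norm_sq f" if "f \<in> S" for f
    unfolding d_def using S_bdd that by (auto intro: cInf_lower)
  have "\<exists>f\<in>S. norm_sq f < d + 1 / real (Suc n)" for n
  proof -
    have "\<exists>y\<in>norm_sq ` S. y < d + 1 / real (Suc n)"
      by (rule cInf_lessD[OF S_ne]) (simp add: d_def)
    then show ?thesis by blast
  qed
  then obtain F where F: "\<And>n. F n \<in> S" "\<And>n. norm_sq (F n) < d + 1 / real (Suc n)"
    by metis
  have FA: "F n \<in> A2" "\<Lambda> (F n) = 1" for n using F(1) by (auto simp: S_def)
  have near: "norm_sq (\<lambda>x. F m x - F n x) \<le> 2 / real (Suc m) + 2 / real (Suc n)" for m n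
  proof -
    have "(\<lambda>x. (1 / 2) * (F m x + F n x)) \<in> S"
      using FA scale[OF A2_add[OF FA(1)[of m] FA(1)[of n]], of "1 / 2"]
      by (auto simp: S_def add intro: A2_cmult[OF A2_add, of _ _ "1 / 2", simplified])
    then have "d \<le> norm_sq (\<lambda>x. (1 / 2) * (F m x + F n x))" by (rule d_le)
    also have "\<dots> = (1 / 4) * norm_sq (\<lambda>x. F m x + F n x)"
      by (subst norm_sq_cmult) (simp add: norm_divide power2_eq_square)
    finally show ?thesis
      using parallelogram[OF FA(1)[of m] FA(1)[of n]] F(2)[of m] F(2)[of n] by argo
  qed
  have "\<exists>N. \<forall>m\<ge>N. \<forall>n\<ge>N. norm_sq (\<lambda>x. F m x - F n x) \<le> e" if e: "e > 0" for e
  proof -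
    obtain N where N: "1 / real (Suc N) < e / 4"
      using nat_approx_posE[of "e / 4"] e by auto
    have "2 / real (Suc n) \<le> e / 2" if "n \<ge> N" for n
    proof -
      have "1 / real (Suc n) \<le> 1 / real (Suc N)" using that by (intro divide_left_mono) auto
      then show ?thesis using N by simp
    qed
    then have "norm_sq (\<lambda>x. F m x - F n x) \<le> e" if "m \<ge> N" "n \<ge> N" for m n
      using near[of m n] that by (smt (verit) field_sum_of_halves)
    then show ?thesis by blast
  qed
  from A2_complete[OF FA(1) this] obtain f where
    f: "f \<in> A2" and lim: "(\<lambda>n. norm_sq (\<lambda>x. F n x - f x)) \<longlonglongrightarrow> 0" by blast
  have limL: "(\<lambda>n. L2norm (\<lambda>x. F n x - f x)) \<longlonglongrightarrow> 0"
    using tendsto_real_sqrt[OF lim] by simp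
  have "(\<lambda>n. 1 - \<Lambda> f) \<longlonglongrightarrow> 0"
  proof (rule Lim_null_comparison)
    have "1 - \<Lambda> f = \<Lambda> (\<lambda>x. F n x - f x)" for n
      using lin[OF FA(1) f, of n 1] FA(2) by simp
    then show "\<forall>\<^sub>F n in sequentially. norm (1 - \<Lambda> f) \<le> C * L2norm (\<lambda>x. F n x - f x)"
      using bnd[OF A2_diff[OF FA(1) f]] by simp
    show "(\<lambda>n. C * L2norm (\<lambda>x. F n x - f x)) \<longlonglongrightarrow> 0"
      using tendsto_mult_left[OF limL, of C] by simp
  qed
  then have f1: "\<Lambda> f = 1" by (simp add: LIMSEQ_const_iff)
  have "L2norm f \<le> sqrt d"
  proof (rule LIMSEQ_le_const)
    have "(\<lambda>n. d + 1 / real (Suc n)) \<longlonglongrightarrow> d + 0"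
      using LIMSEQ_inverse_real_of_nat by (intro tendsto_add) (auto simp: inverse_eq_divide)
    from tendsto_add[OF tendsto_real_sqrt[OF this] limL]
    show "(\<lambda>n. sqrt (d + 1 / real (Suc n)) + L2norm (\<lambda>x. F n x - f x)) \<longlonglongrightarrow> sqrt d" by simp
    have "L2norm f \<le> sqrt (d + 1 / real (Suc n)) + L2norm (\<lambda>x. F n x - f x)" for n
    proof -
      have "L2norm f \<le> L2norm (F n) + L2norm (\<lambda>x. F n x - f x)"
        using L2norm_triangle[OF FA(1)[of n] A2_diff[OF FA(1)[of n] f]] by simp
      moreover have "L2norm (F n) \<le> sqrt (d + 1 / real (Suc n))"
        using F(2)[of n] by (intro real_sqrt_le_mono) simp
      ultimately show ?thesis by linarith
    qed
    then show "\<exists>N. \<forall>n\<ge>N. L2norm f \<le> sqrt (d + 1 / real (Suc n)) + L2norm (\<lambda>x. F n x - f x)" by blast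
  qed
  then have f_min: "norm_sq f \<le> d" by simp
  have orth: "ip f g = 0" if g: "g \<in> A2" "\<Lambda> g = 0" for g
  proof (rule orthogonal_if_minimal[OF f g(1)])
    fix c
    have "(\<lambda>x. f x - c * g x) \<in> S"
      using f g by (simp add: S_def A2_intros lin f1)
    then show "norm_sq f \<le> norm_sq (\<lambda>x. f x - c * g x)"
      using d_le f_min by (meson order_trans)
  qed
  have "norm_sq f \<noteq> 0" using bnd[OF f] f1 by auto
  define k where "k = (\<lambda>x. complex_of_real (1 / norm_sq f) * f x)"
  have "\<Lambda> h = ip h k" if h: "h \<in> A2" for h
  proof -
    have "ip f (\<lambda>x. h x - \<Lambda> h * f x) = 0"
      by (rule orth) (simp_all add: lin f h f1 A2_intros)
    then have "ip (\<lambda>x. h x - \<Lambda> h * f x) f = 0"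
      using ip_commute[of "\<lambda>x. h x - \<Lambda> h * f x" f] by simp
    then have "ip h f = \<Lambda> h * norm_sq f"
      by (simp add: ip_diff_left ip_cmult_left ip_self f h A2_intros)
    then show ?thesis
      using \<open>norm_sq f \<noteq> 0\<close> by (simp add: k_def ip_cmult_right del: of_real_divide times_divide_eq_left)
        (simp add: divide_simps)
  qed
  moreover have "k \<in> A2" unfolding k_def by (rule A2_cmult[OF f])
  ultimately show ?thesis by blast
qed

definition representer :: "((complex ^ 'n \<Rightarrow> complex) \<Rightarrow> complex) \<Rightarrow> complex ^ 'n \<Rightarrow> complex" where
  "representer \<Lambda> = (SOME k. k \<in> A2 \<and> (\<forall>f\<in>A2. \<Lambda> f = ip f k))"

text \<open>The identity for \<open>f - c g\<close> expresses additivity and homogeneity at once.\<close>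

definition bounded_functional :: "((complex ^ 'n \<Rightarrow> complex) \<Rightarrow> complex) \<Rightarrow> bool" where
  "bounded_functional \<Lambda> \<longleftrightarrow>
    (\<forall>f\<in>A2. \<forall>g\<in>A2. \<forall>c. \<Lambda> (\<lambda>x. f x - c * g x) = \<Lambda> f - c * \<Lambda> g) \<and>
    (\<exists>C. \<forall>f\<in>A2. cmod (\<Lambda> f) \<le> C * L2norm f)"

lemma
  assumes "bounded_functional \<Lambda>"
  shows representer_A2: "representer \<Lambda> \<in> A2" and ip_representer: "f \<in> A2 \<Longrightarrow> ip f (representer \<Lambda>) = \<Lambda> f"
proof -
  have "\<exists>k. k \<in> A2 \<and> (\<forall>f\<in>A2. \<Lambda> f = ip f k)"
    using assms riesz_representation[of \<Lambda>] unfolding bounded_functional_def by blast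
  from someI_ex[OF this] show "representer \<Lambda> \<in> A2" "f \<in> A2 \<Longrightarrow> ip f (representer \<Lambda>) = \<Lambda> f"
    by (auto simp: representer_def)
qed

text \<open>This turns a pointwise estimate that is uniform over all functions of the space into a norm
  estimate for the representing function.\<close>

lemma L2norm_le_dual:
  assumes "p \<in> A2" "C \<ge> 0" "\<And>f. f \<in> A2 \<Longrightarrow> cmod (ip f p) \<le> C * L2norm f"
  shows "L2norm p \<le> C"
proof (cases "norm_sq p = 0")
  case False
  then have pos: "L2norm p > 0" using norm_sq_nonneg[of p] by simp
  have "L2norm p * L2norm p \<le> C * L2norm p"
    using assms(3)[OF assms(1)] by (simp add: ip_self norm_sq_nonneg)
  then show ?thesis using pos mult_le_cancel_right_pos by blast
qed (use assms(2) in simp)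

end

section \<open>Representers of evaluations and derivatives\<close>

lemma grad_apply_cong:
  assumes "open D" "z \<in> D" "holomorphic_scv D f" "\<And>x. x \<in> D \<Longrightarrow> g x = f x"
  shows "grad_apply g z = grad_apply f z"
proof (rule grad_apply_eq)
  show "(g has_derivative grad_apply f z) (at z)"
    using has_derivative_transform_within_open[OF holomorphic_scv_derivative[OF assms(3,2)] assms(1,2)]
      assms(4) by metis
qed (rule grad_apply_scale)

context bounded_open_set begin

text \<open>Every derivative taken costs a shrinking of the ball by \<open>s\<close>; starting with radius \<open>4 s\<close>
  leaves room for the three that the last estimate needs.\<close>

lemma local_estimates:
  assumes "z \<in> D"
  obtains s C where "s > 0" "C \<ge> 0" "ball z s \<subseteq> D"
    "\<And>f x. f \<in> A2 \<Longrightarrow> x \<in> ball z s \<Longrightarrow> cmod (f x) \<le> C * L2norm f"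
    "\<And>f x u. f \<in> A2 \<Longrightarrow> x \<in> ball z s \<Longrightarrow> cmod (grad_apply f x u) \<le> C * norm u * L2norm f"
    "\<And>f x u v. f \<in> A2 \<Longrightarrow> x \<in> ball z s \<Longrightarrow>
      cmod (grad_apply (\<lambda>x. grad_apply f x u) x v) \<le> C * norm u * norm v * L2norm f"
    "\<And>f x y. f \<in> A2 \<Longrightarrow> x \<in> ball z s \<Longrightarrow> y \<in> ball z s \<Longrightarrow>
      cmod (f y - f x) \<le> C * norm (y - x) * L2norm f"
    "\<And>f x y u. f \<in> A2 \<Longrightarrow> x \<in> ball z s \<Longrightarrow> y \<in> ball z s \<Longrightarrow>
      cmod (grad_apply f y u - grad_apply f x u) \<le> C * norm u * norm (y - x) * L2norm f"
    "\<And>f x y. f \<in> A2 \<Longrightarrow> x \<in> ball z s \<Longrightarrow> y \<in> ball z s \<Longrightarrow>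
      cmod (f y - f x - grad_apply f x (y - x)) \<le> C * (norm (y - x))\<^sup>2 * L2norm f"
    "\<And>f x y u. f \<in> A2 \<Longrightarrow> x \<in> ball z s \<Longrightarrow> y \<in> ball z s \<Longrightarrow>
      cmod (grad_apply f y u - grad_apply f x u - grad_apply (\<lambda>x. grad_apply f x u) x (y - x))
        \<le> C * norm u * (norm (y - x))\<^sup>2 * L2norm f"
proof -
  obtain R where R: "R > 0" "ball z (2 * R) \<subseteq> D" using double_ball_inside[OF assms] .
  define s where "s = R / 4"
  have s: "s > 0" using R by (simp add: s_def)
  have Rs: "R - s = 3 * s" "R - 2 * s = 2 * s" "R - s - s = 2 * s" "R - s - 2 * s = s"
    by (simp_all add: s_def)
  define K where "K = 1 / sqrt (ball_vol R)"
  have K: "K > 0" using ball_vol_pos[OF R(1)] by (simp add: K_def)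
  define C where "C = K + K / s + K / s / s + K / s / s / s"
  have C: "K \<le> C" "K / s \<le> C" "K / s / s \<le> C" "K / s / s / s \<le> C" "0 \<le> C"
    using K s by (simp_all add: C_def)
  have sub: "ball z R \<subseteq> D" using R by auto
  then have sub': "ball z (R - s) \<subseteq> D" using s by auto
  have balls: "ball z s \<subseteq> ball z R" "ball z s \<subseteq> ball z (R - s)" "ball z s \<subseteq> ball z (R - 2 * s)"
    "ball z s \<subseteq> ball z (R - s - s)"
    unfolding Rs using s by (auto simp: s_def)
  have M: "cmod (f x) \<le> K * L2norm f" if "f \<in> A2" "x \<in> ball z R" for f x
    using evaluation_bound[OF R that(2,1)] by (simp add: K_def)
  note hol = A2_holomorphic
  have hol': "holomorphic_scv D (\<lambda>x. grad_apply f x u)" if "f \<in> A2" for f u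
    by (rule holomorphic_scv_grad_apply[OF open_D hol[OF that]])
  have M': "cmod (grad_apply f x u) \<le> K / s * norm u * L2norm f" if "f \<in> A2" "x \<in> ball z (R - s)" for f x u
    using grad_apply_bound[OF hol[OF that(1)] sub M[OF that(1)] s that(2), of u] by (simp add: mult_ac)
  have le: "c * a * L2norm f \<le> C * a * L2norm f" if "c \<le> C" "a \<ge> 0" for c a f
    using that norm_sq_nonneg[of f] by (intro mult_right_mono) auto
  show ?thesis
  proof (rule that[OF s C(5)])
    show "ball z s \<subseteq> D" using balls(1) sub by blast
    show "cmod (f x) \<le> C * L2norm f" if "f \<in> A2" "x \<in> ball z s" for f x
      using M[OF that(1)] that(2) balls(1) le[OF C(1), of 1 f] by force
    show "cmod (grad_apply f x u) \<le> C * norm u * L2norm f" if "f \<in> A2" "x \<in> ball z s" for f x u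
      by (rule order_trans[OF M'[OF that(1)] le[OF C(2)]]) (use that balls in auto)
    show "cmod (grad_apply (\<lambda>x. grad_apply f x u) x v) \<le> C * norm u * norm v * L2norm f"
      if "f \<in> A2" "x \<in> ball z s" for f x u v
    proof -
      have x: "x \<in> ball z (R - s - s)" using that balls by blast
      have "cmod (grad_apply (\<lambda>x. grad_apply f x u) x v)
          \<le> K / s * norm u * L2norm f / s * norm v"
        by (rule grad_apply_bound[OF hol'[OF that(1)] sub' M'[OF that(1)] s x])
      also have "\<dots> = K / s / s * (norm u * norm v) * L2norm f" by simp
      also have "\<dots> \<le> C * (norm u * norm v) * L2norm f" by (rule le[OF C(3)]) simp
      finally show ?thesis by (simp add: mult_ac)
    qed
    show "cmod (f y - f x) \<le> C * norm (y - x) * L2norm f"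
      if "f \<in> A2" "x \<in> ball z s" "y \<in> ball z s" for f x y
    proof -
      have xy: "y \<in> ball z (R - s)" "x \<in> ball z (R - s)" using that balls by blast+
      have "cmod (f y - f x) \<le> K * L2norm f / s * norm (y - x)"
        by (rule holomorphic_scv_lipschitz[OF hol[OF that(1)] sub M[OF that(1)] s xy])
      also have "\<dots> = K / s * norm (y - x) * L2norm f" by simp
      also have "\<dots> \<le> C * norm (y - x) * L2norm f" by (rule le[OF C(2)]) simp
      finally show ?thesis .
    qed
    show "cmod (grad_apply f y u - grad_apply f x u) \<le> C * norm u * norm (y - x) * L2norm f"
      if "f \<in> A2" "x \<in> ball z s" "y \<in> ball z s" for f x y u
    proof -
      have xy: "x \<in> ball z (R - 2 * s)" "y \<in> ball z (R - 2 * s)" using that balls by blast+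
      have "cmod (grad_apply f y u - grad_apply f x u)
          \<le> K * L2norm f / s * norm (y - x) / s * norm u"
        by (rule grad_apply_lipschitz[OF hol[OF that(1)] sub M[OF that(1)] s xy])
      also have "\<dots> = K / s / s * (norm u * norm (y - x)) * L2norm f" by simp
      also have "\<dots> \<le> C * (norm u * norm (y - x)) * L2norm f" by (rule le[OF C(3)]) simp
      finally show ?thesis by (simp add: mult_ac)
    qed
    show "cmod (f y - f x - grad_apply f x (y - x)) \<le> C * (norm (y - x))\<^sup>2 * L2norm f"
      if "f \<in> A2" "x \<in> ball z s" "y \<in> ball z s" for f x y
    proof -
      have xy: "x \<in> ball z (R - 2 * s)" "y \<in> ball z (R - 2 * s)" using that balls by blast+
      have "cmod (f y - f x - grad_apply f x (y - x)) \<le> K * L2norm f / s / s * (norm (y - x))\<^sup>2"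
        by (rule grad_apply_linearization[OF hol[OF that(1)] sub M[OF that(1)] s xy])
      also have "\<dots> = K / s / s * (norm (y - x))\<^sup>2 * L2norm f" by simp
      also have "\<dots> \<le> C * (norm (y - x))\<^sup>2 * L2norm f" by (rule le[OF C(3)]) simp
      finally show ?thesis .
    qed
    show "cmod (grad_apply f y u - grad_apply f x u - grad_apply (\<lambda>x. grad_apply f x u) x (y - x))
        \<le> C * norm u * (norm (y - x))\<^sup>2 * L2norm f"
      if "f \<in> A2" "x \<in> ball z s" "y \<in> ball z s" for f x y u
    proof -
      have xy: "x \<in> ball z (R - s - 2 * s)" "y \<in> ball z (R - s - 2 * s)" using that Rs by auto
      have "cmod (grad_apply f y u - grad_apply f x u - grad_apply (\<lambda>x. grad_apply f x u) x (y - x))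
          \<le> K / s * norm u * L2norm f / s / s * (norm (y - x))\<^sup>2"
        by (rule grad_apply_linearization[OF hol'[OF that(1)] sub' M'[OF that(1)] s xy])
      also have "\<dots> = K / s / s / s * (norm u * (norm (y - x))\<^sup>2) * L2norm f" by simp
      also have "\<dots> \<le> C * (norm u * (norm (y - x))\<^sup>2) * L2norm f" by (rule le[OF C(4)]) simp
      finally show ?thesis by (simp add: mult_ac)
    qed
  qed
qed

text \<open>\<open>ker w\<close> is \<open>K(\<cdot>, w)\<close>; \<open>ker1\<close> and \<open>ker2\<close> are its first and second derivatives with respect to
  \<open>w\<close>. They are antilinear in the directions. As functions they are determined only on \<open>D\<close>, so
  identities between them are stated through \<open>ip\<close> or \<open>norm_sq\<close>.\<close>

definition ker :: "complex ^ 'n \<Rightarrow> complex ^ 'n \<Rightarrow> complex" where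
  "ker w = representer (\<lambda>f. f w)"

definition ker1 :: "complex ^ 'n \<Rightarrow> complex ^ 'n \<Rightarrow> complex ^ 'n \<Rightarrow> complex" where
  "ker1 w u = representer (\<lambda>f. grad_apply f w u)"

definition ker2 :: "complex ^ 'n \<Rightarrow> complex ^ 'n \<Rightarrow> complex ^ 'n \<Rightarrow> complex ^ 'n \<Rightarrow> complex" where
  "ker2 w u v = representer (\<lambda>f. grad_apply (\<lambda>x. grad_apply f x u) w v)"

lemma bounded_functionals:
  assumes "w \<in> D"
  shows "bounded_functional (\<lambda>f. f w)" "bounded_functional (\<lambda>f. grad_apply f w u)"
    "bounded_functional (\<lambda>f. grad_apply (\<lambda>x. grad_apply f x u) w v)"
proof -
  obtain s C where s: "s > 0" and C: "C \<ge> 0"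
    and est: "\<And>f x. f \<in> A2 \<Longrightarrow> x \<in> ball w s \<Longrightarrow> cmod (f x) \<le> C * L2norm f"
    "\<And>f x u. f \<in> A2 \<Longrightarrow> x \<in> ball w s \<Longrightarrow> cmod (grad_apply f x u) \<le> C * norm u * L2norm f"
    "\<And>f x u v. f \<in> A2 \<Longrightarrow> x \<in> ball w s \<Longrightarrow>
      cmod (grad_apply (\<lambda>x. grad_apply f x u) x v) \<le> C * norm u * norm v * L2norm f"
    by (rule local_estimates[OF assms]) (rule that; assumption)
  have w: "w \<in> ball w s" using s by simp
  have g1: "grad_apply (\<lambda>x. f x - c * g x) x u = grad_apply f x u - c * grad_apply g x u"
    if "f \<in> A2" "g \<in> A2" "x \<in> D" for f g c x u
    using that by (simp add: grad_apply_diff[OF A2_holomorphic holomorphic_scv_cmult[OF A2_holomorphic]]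
        grad_apply_cmult[OF A2_holomorphic])
  have g2: "grad_apply (\<lambda>x. grad_apply (\<lambda>x. f x - c * g x) x u) w v
      = grad_apply (\<lambda>x. grad_apply f x u) w v - c * grad_apply (\<lambda>x. grad_apply g x u) w v"
    if fg: "f \<in> A2" "g \<in> A2" for f g c
  proof -
    have h: "holomorphic_scv D (\<lambda>x. grad_apply f x u)" "holomorphic_scv D (\<lambda>x. grad_apply g x u)"
      using fg by (auto intro: holomorphic_scv_grad_apply[OF open_D] A2_holomorphic)
    have "grad_apply (\<lambda>x. grad_apply (\<lambda>x. f x - c * g x) x u) w
        = grad_apply (\<lambda>x. grad_apply f x u - c * grad_apply g x u) w"
      by (rule grad_apply_cong[OF open_D assms])
        (use h g1[OF fg] in \<open>auto intro: holomorphic_scv_diff holomorphic_scv_cmult\<close>)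
    then show ?thesis
      by (simp add: grad_apply_diff[OF h(1) holomorphic_scv_cmult[OF h(2)] assms]
          grad_apply_cmult[OF h(2) assms])
  qed
  show "bounded_functional (\<lambda>f. f w)"
    unfolding bounded_functional_def using est(1)[OF _ w] by auto
  show "bounded_functional (\<lambda>f. grad_apply f w u)"
    unfolding bounded_functional_def using est(2)[OF _ w] g1[OF _ _ assms]
    by (auto intro!: exI[of _ "C * norm u"])
  show "bounded_functional (\<lambda>f. grad_apply (\<lambda>x. grad_apply f x u) w v)"
    unfolding bounded_functional_def using est(3)[OF _ w] g2
    by (auto intro!: exI[of _ "C * norm u * norm v"])
qed

lemma
  assumes "w \<in> D"
  shows ker_A2: "ker w \<in> A2" and ker1_A2: "ker1 w u \<in> A2" and ker2_A2: "ker2 w u v \<in> A2"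
    and ip_ker: "f \<in> A2 \<Longrightarrow> ip f (ker w) = f w"
    and ip_ker1: "f \<in> A2 \<Longrightarrow> ip f (ker1 w u) = grad_apply f w u"
    and ip_ker2: "f \<in> A2 \<Longrightarrow> ip f (ker2 w u v) = grad_apply (\<lambda>x. grad_apply f x u) w v"
  unfolding ker_def ker1_def ker2_def
  by (auto intro!: representer_A2 ip_representer bounded_functionals assms)

text \<open>The dual form of the estimates for functions: \<open>ker\<close> and \<open>ker1\<close> are differentiable in norm, with
  quadratic error.\<close>

lemma ker_estimates:
  assumes "z \<in> D"
  obtains s C where "s > 0" "C \<ge> 0" "ball z s \<subseteq> D"
    "\<And>y. y \<in> ball z s \<Longrightarrow> L2norm (\<lambda>x. ker y x - ker z x) \<le> C * norm (y - z)"
    "\<And>y u. y \<in> ball z s \<Longrightarrow> L2norm (\<lambda>x. ker1 y u x - ker1 z u x) \<le> C * norm u * norm (y - z)"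
    "\<And>y. y \<in> ball z s \<Longrightarrow> L2norm (\<lambda>x. ker y x - ker z x - ker1 z (y - z) x) \<le> C * (norm (y - z))\<^sup>2"
    "\<And>y u. y \<in> ball z s \<Longrightarrow>
      L2norm (\<lambda>x. ker1 y u x - ker1 z u x - ker2 z u (y - z) x) \<le> C * norm u * (norm (y - z))\<^sup>2"
proof -
  obtain s C where s: "s > 0" and C: "C \<ge> 0" and sub: "ball z s \<subseteq> D"
    and est: "\<And>f x y. f \<in> A2 \<Longrightarrow> x \<in> ball z s \<Longrightarrow> y \<in> ball z s \<Longrightarrow>
      cmod (f y - f x) \<le> C * norm (y - x) * L2norm f"
    "\<And>f x y u. f \<in> A2 \<Longrightarrow> x \<in> ball z s \<Longrightarrow> y \<in> ball z s \<Longrightarrow>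
      cmod (grad_apply f y u - grad_apply f x u) \<le> C * norm u * norm (y - x) * L2norm f"
    "\<And>f x y. f \<in> A2 \<Longrightarrow> x \<in> ball z s \<Longrightarrow> y \<in> ball z s \<Longrightarrow>
      cmod (f y - f x - grad_apply f x (y - x)) \<le> C * (norm (y - x))\<^sup>2 * L2norm f"
    "\<And>f x y u. f \<in> A2 \<Longrightarrow> x \<in> ball z s \<Longrightarrow> y \<in> ball z s \<Longrightarrow>
      cmod (grad_apply f y u - grad_apply f x u - grad_apply (\<lambda>x. grad_apply f x u) x (y - x))
        \<le> C * norm u * (norm (y - x))\<^sup>2 * L2norm f"
    by (rule local_estimates[OF assms]) (rule that; assumption)
  have z: "z \<in> ball z s" using s by simp
  show ?thesis
  proof (rule that[OF s C sub])
    fix y u assume y: "y \<in> ball z s"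
    then have yD: "y \<in> D" using sub by blast
    note mem = ker_A2[OF assms] ker1_A2[OF assms] ker2_A2[OF assms] ker_A2[OF yD] ker1_A2[OF yD]
    note ips = ip_ker[OF assms] ip_ker1[OF assms] ip_ker2[OF assms] ip_ker[OF yD] ip_ker1[OF yD]
    show "L2norm (\<lambda>x. ker y x - ker z x) \<le> C * norm (y - z)"
      by (rule L2norm_le_dual)
        (use C est(1)[OF _ z y] in \<open>auto simp: ip_diff_right mem ips intro!: A2_diff mem\<close>)
    show "L2norm (\<lambda>x. ker1 y u x - ker1 z u x) \<le> C * norm u * norm (y - z)"
      by (rule L2norm_le_dual)
        (use C est(2)[OF _ z y] in \<open>auto simp: ip_diff_right mem ips intro!: A2_diff mem\<close>)
    show "L2norm (\<lambda>x. ker y x - ker z x - ker1 z (y - z) x) \<le> C * (norm (y - z))\<^sup>2"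
      by (rule L2norm_le_dual)
        (use C est(3)[OF _ z y] in \<open>auto simp: ip_diff_right A2_diff mem ips intro!: A2_diff mem\<close>)
    show "L2norm (\<lambda>x. ker1 y u x - ker1 z u x - ker2 z u (y - z) x) \<le> C * norm u * (norm (y - z))\<^sup>2"
      by (rule L2norm_le_dual)
        (use C est(4)[OF _ z y] in \<open>auto simp: ip_diff_right A2_diff mem ips intro!: A2_diff mem\<close>)
  qed
qed

end

section \<open>The Bergman metric as a Gram determinant\<close>

lemma has_vector_derivative_quadratic:
  fixes F :: "real \<Rightarrow> 'a::real_normed_vector"
  assumes "\<delta> > 0" and bnd: "\<And>t. \<bar>t\<bar> < \<delta> \<Longrightarrow> norm (F t - F 0 - t *\<^sub>R d) \<le> K * t\<^sup>2"
  shows "(F has_vector_derivative d) (at 0)"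
  unfolding has_vector_derivative_def has_derivative_at
proof (intro conjI bounded_linear_scaleR_left)
  show "(\<lambda>h. norm (F (0 + h) - F 0 - h *\<^sub>R d) / norm h) \<midarrow>0\<rightarrow> 0"
  proof (rule Lim_null_comparison)
    have "\<forall>\<^sub>F h in at 0. \<bar>h\<bar> < \<delta>"
      using assms(1) by (auto simp: eventually_at intro!: exI[of _ \<delta>])
    moreover have "\<forall>\<^sub>F h in at (0::real). h \<noteq> 0"
      by (simp add: eventually_at_filter)
    ultimately show "\<forall>\<^sub>F h in at 0. norm (norm (F (0 + h) - F 0 - h *\<^sub>R d) / norm h) \<le> K * \<bar>h\<bar>"
    proof eventually_elim
      case (elim h)
      have "norm (F h - F 0 - h *\<^sub>R d) \<le> K * \<bar>h\<bar> * \<bar>h\<bar>"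
        using bnd[OF elim(1)] by (simp add: power2_eq_square mult.assoc)
      then show ?case using elim(2) by (simp add: divide_le_eq)
    qed
    show "(\<lambda>h. K * \<bar>h\<bar>) \<midarrow>0\<rightarrow> 0"
      by (auto intro!: tendsto_eq_intros)
  qed
qed

context bounded_open_set begin

text \<open>The product rule for curves in the Bergman space that are differentiable in norm.\<close>

lemma ip_has_vector_derivative:
  assumes A: "a' \<in> A2" "b' \<in> A2" and \<delta>: "\<delta> > 0"
    and at: "\<And>t. \<bar>t\<bar> < \<delta> \<Longrightarrow> a t \<in> A2" and bt: "\<And>t. \<bar>t\<bar> < \<delta> \<Longrightarrow> b t \<in> A2"
    and ad: "\<And>t. \<bar>t\<bar> < \<delta> \<Longrightarrow> L2norm (\<lambda>x. a t x - a 0 x - of_real t * a' x) \<le> C * t\<^sup>2"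
    and bd: "\<And>t. \<bar>t\<bar> < \<delta> \<Longrightarrow> L2norm (\<lambda>x. b t x - b 0 x - of_real t * b' x) \<le> C * t\<^sup>2"
  shows "((\<lambda>t. ip (a t) (b t)) has_vector_derivative ip a' (b 0) + ip (a 0) b') (at 0)"
proof (rule has_vector_derivative_quadratic)
  define Q where "Q = cmod (ip a' b') + C * (L2norm (b 0) + L2norm b')
    + (L2norm (a 0) + L2norm a') * C + C * C"
  show "min \<delta> 1 > 0" using \<delta> by simp
  fix t :: real assume t: "\<bar>t\<bar> < min \<delta> 1"
  then have t\<delta>: "\<bar>t\<bar> < \<delta>" and t1: "\<bar>t\<bar> \<le> 1" by auto
  have t2: "t\<^sup>2 \<le> 1" using t1 by (simp add: abs_square_le_1)
  have a0: "a 0 \<in> A2" and b0: "b 0 \<in> A2" using \<delta> by (auto intro: at bt)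
  define \<alpha> where "\<alpha> = (\<lambda>x. a t x - a 0 x - of_real t * a' x)"
  define \<beta> where "\<beta> = (\<lambda>x. b t x - b 0 x - of_real t * b' x)"
  have mem: "\<alpha> \<in> A2" "\<beta> \<in> A2" "a 0 \<in> A2" "b 0 \<in> A2" "a' \<in> A2" "b' \<in> A2"
    using A a0 b0 at[OF t\<delta>] bt[OF t\<delta>] by (auto simp: \<alpha>_def \<beta>_def intro!: A2_intros)
  have \<alpha>: "L2norm \<alpha> \<le> C * t\<^sup>2" and \<beta>: "L2norm \<beta> \<le> C * t\<^sup>2"
    using ad[OF t\<delta>] bd[OF t\<delta>] by (simp_all add: \<alpha>_def \<beta>_def)
  have C: "0 \<le> C"
  proof -
    have "0 \<le> C * (\<delta> / 2)\<^sup>2"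
      using order_trans[OF _ ad[of "\<delta> / 2"]] \<delta> by (simp add: norm_sq_nonneg)
    then show ?thesis using \<delta> by (simp add: zero_le_mult_iff)
  qed
  have abs_t: "\<bar>t\<bar> * c \<le> c" if "c \<ge> 0" for c
    using mult_right_mono[OF t1 that] by simp
  have eq_a: "a t = (\<lambda>x. (a 0 x + of_real t * a' x) + \<alpha> x)"
    and eq_b: "b t = (\<lambda>x. (b 0 x + of_real t * b' x) + \<beta> x)"
    by (auto simp: \<alpha>_def \<beta>_def)
  have "ip (a t) (b t) - ip (a 0) (b 0) - t *\<^sub>R (ip a' (b 0) + ip (a 0) b')
      = of_real (t\<^sup>2) * ip a' b' + (ip \<alpha> (b 0) + of_real t * ip \<alpha> b')
        + (ip (a 0) \<beta> + of_real t * ip a' \<beta>) + ip \<alpha> \<beta>"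
    unfolding eq_a eq_b using mem
    by (simp add: ip_add_left ip_add_right ip_cmult_left ip_cmult_right A2_intros scaleR_conv_of_real
        algebra_simps power2_eq_square)
  also have "cmod \<dots> \<le> t\<^sup>2 * cmod (ip a' b') + (C * t\<^sup>2 * L2norm (b 0) + C * t\<^sup>2 * L2norm b')
        + (L2norm (a 0) * (C * t\<^sup>2) + L2norm a' * (C * t\<^sup>2)) + C * t\<^sup>2 * C"
  proof (intro norm_triangle_mono)
    show "cmod (of_real (t\<^sup>2) * ip a' b') \<le> t\<^sup>2 * cmod (ip a' b')"
      by (simp add: norm_mult norm_power)
    have le1: "cmod (ip \<alpha> g) \<le> C * t\<^sup>2 * L2norm g" if "g \<in> A2" for g
      using Cauchy_Schwarz[OF mem(1) that] mult_right_mono[OF \<alpha>, of "L2norm g"] norm_sq_nonneg[of g]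
      by simp
    have le2: "cmod (ip g \<beta>) \<le> L2norm g * (C * t\<^sup>2)" if "g \<in> A2" for g
      using Cauchy_Schwarz[OF that mem(2)] mult_left_mono[OF \<beta>, of "L2norm g"] norm_sq_nonneg[of g]
      by simp
    show "cmod (ip \<alpha> (b 0)) \<le> C * t\<^sup>2 * L2norm (b 0)" "cmod (ip (a 0) \<beta>) \<le> L2norm (a 0) * (C * t\<^sup>2)"
      using le1 le2 mem by auto
    show "cmod (of_real t * ip \<alpha> b') \<le> C * t\<^sup>2 * L2norm b'"
      using le1[OF mem(6)] abs_t[of "cmod (ip \<alpha> b')"] by (simp add: norm_mult)
    show "cmod (of_real t * ip a' \<beta>) \<le> L2norm a' * (C * t\<^sup>2)"
      using le2[OF mem(5)] abs_t[of "cmod (ip a' \<beta>)"] by (simp add: norm_mult)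
    have "L2norm \<beta> \<le> C"
      using \<beta> mult_left_mono[OF t2 C] by simp
    then show "cmod (ip \<alpha> \<beta>) \<le> C * t\<^sup>2 * C"
      using le1[OF mem(2)] mult_left_mono[of "L2norm \<beta>" C "C * t\<^sup>2"] C by simp
  qed
  also have "\<dots> = Q * t\<^sup>2" by (simp add: Q_def algebra_simps)
  finally show "cmod (ip (a t) (b t) - ip (a 0) (b 0) - t *\<^sub>R (ip a' (b 0) + ip (a 0) b')) \<le> Q * t\<^sup>2" .
qed

lemma ip_continuous_at:
  assumes "s > 0" and A: "\<And>y. y \<in> ball z s \<Longrightarrow> a y \<in> A2" "\<And>y. y \<in> ball z s \<Longrightarrow> b y \<in> A2"
    and ad: "\<And>y. y \<in> ball z s \<Longrightarrow> L2norm (\<lambda>x. a y x - a z x) \<le> Ca * norm (y - z)"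
    and bd: "\<And>y. y \<in> ball z s \<Longrightarrow> L2norm (\<lambda>x. b y x - b z x) \<le> Cb * norm (y - z)"
  shows "isCont (\<lambda>y. ip (a y) (b y)) z"
  unfolding isCont_def
proof (rule LIM_zero_cancel, rule Lim_null_comparison)
  have z: "z \<in> ball z s" using assms(1) by simp
  have "cmod (ip (a y) (b y) - ip (a z) (b z))
      \<le> Ca * norm (y - z) * L2norm (b z) + L2norm (a z) * (Cb * norm (y - z))
        + Ca * norm (y - z) * (Cb * norm (y - z))" if y: "y \<in> ball z s" for y
  proof -
    define \<alpha> where "\<alpha> = (\<lambda>x. a y x - a z x)"
    define \<beta> where "\<beta> = (\<lambda>x. b y x - b z x)"
    have mem: "\<alpha> \<in> A2" "\<beta> \<in> A2" "a z \<in> A2" "b z \<in> A2"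
      using A[OF y] A[OF z] by (auto simp: \<alpha>_def \<beta>_def intro: A2_diff)
    have \<alpha>: "L2norm \<alpha> \<le> Ca * norm (y - z)" and \<beta>: "L2norm \<beta> \<le> Cb * norm (y - z)"
      using ad[OF y] bd[OF y] by (simp_all add: \<alpha>_def \<beta>_def)
    have eq_a: "a y = (\<lambda>x. a z x + \<alpha> x)" and eq_b: "b y = (\<lambda>x. b z x + \<beta> x)"
      by (auto simp: \<alpha>_def \<beta>_def)
    have "ip (a y) (b y) - ip (a z) (b z) = ip \<alpha> (b z) + ip (a z) \<beta> + ip \<alpha> \<beta>"
      unfolding eq_a eq_b using mem by (simp add: ip_add_left ip_add_right A2_add)
    also have "cmod \<dots> \<le> L2norm \<alpha> * L2norm (b z) + L2norm (a z) * L2norm \<beta> + L2norm \<alpha> * L2norm \<beta>"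
      using mem by (intro norm_triangle_mono Cauchy_Schwarz)
    also have "\<dots> \<le> Ca * norm (y - z) * L2norm (b z) + L2norm (a z) * (Cb * norm (y - z))
        + Ca * norm (y - z) * (Cb * norm (y - z))"
      using order_trans[OF _ \<alpha>, of 0]
      by (intro add_mono mult_mono \<alpha> \<beta> order_refl) (simp_all add: norm_sq_nonneg)
    finally show ?thesis .
  qed
  then show "\<forall>\<^sub>F y in at z. norm (ip (a y) (b y) - ip (a z) (b z))
      \<le> Ca * norm (y - z) * L2norm (b z) + L2norm (a z) * (Cb * norm (y - z))
        + Ca * norm (y - z) * (Cb * norm (y - z))"
    using assms(1) by (auto simp: eventually_at dist_commute intro!: exI[of _ s])
  show "((\<lambda>y. Ca * norm (y - z) * L2norm (b z) + L2norm (a z) * (Cb * norm (y - z))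
        + Ca * norm (y - z) * (Cb * norm (y - z))) \<longlongrightarrow> 0) (at z)"
    by (auto intro!: tendsto_eq_intros)
qed

lemma
  assumes "z \<in> D"
  shows continuous_ip_ker_ker: "isCont (\<lambda>w. ip (ker w) (ker w)) z"
    and continuous_ip_ker1_ker: "isCont (\<lambda>w. ip (ker1 w u) (ker w)) z"
    and continuous_ip_ker_ker1: "isCont (\<lambda>w. ip (ker w) (ker1 w u)) z"
    and continuous_ip_ker1_ker1: "isCont (\<lambda>w. ip (ker1 w u) (ker1 w v)) z"
proof -
  obtain s C where s: "s > 0" and sub: "ball z s \<subseteq> D" and
    est: "\<And>y. y \<in> ball z s \<Longrightarrow> L2norm (\<lambda>x. ker y x - ker z x) \<le> C * norm (y - z)"
    "\<And>y u. y \<in> ball z s \<Longrightarrow> L2norm (\<lambda>x. ker1 y u x - ker1 z u x) \<le> C * norm u * norm (y - z)"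
    by (rule ker_estimates[OF assms]) (rule that; assumption)
  have mem: "ker y \<in> A2" "ker1 y u \<in> A2" if "y \<in> ball z s" for y u
    using that sub ker_A2 ker1_A2 by blast+
  show "isCont (\<lambda>w. ip (ker w) (ker w)) z" "isCont (\<lambda>w. ip (ker1 w u) (ker w)) z"
    "isCont (\<lambda>w. ip (ker w) (ker1 w u)) z" "isCont (\<lambda>w. ip (ker1 w u) (ker1 w v)) z"
    by (rule ip_continuous_at[OF s]; (rule mem est; assumption))+
qed

lemma ip_ker1_scale:
  assumes "z \<in> D" "f \<in> A2"
  shows "ip f (ker1 z (c *s u)) = c * ip f (ker1 z u)"
    "ip (ker1 z (c *s u)) f = cnj c * ip (ker1 z u) f"
proof -
  show *: "ip f (ker1 z (c *s u)) = c * ip f (ker1 z u)"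
    by (simp add: ip_ker1 assms grad_apply_scale)
  show "ip (ker1 z (c *s u)) f = cnj c * ip (ker1 z u) f"
    by (subst (1 2) ip_commute) (simp add: *)
qed

lemma ip_ker2_scale:
  assumes "z \<in> D" "f \<in> A2"
  shows "ip (ker2 z u (c *s v)) f = cnj c * ip (ker2 z u v) f"
  by (subst (1 2) ip_commute) (simp add: ip_ker2 assms grad_apply_scale)

lemma norm_sq_unique_diff:
  assumes "p \<in> A2" "q \<in> A2" "\<And>f. f \<in> A2 \<Longrightarrow> ip f p = ip f q"
  shows "norm_sq (\<lambda>x. p x - q x) = 0"
proof -
  have "ip (\<lambda>x. p x - q x) (\<lambda>x. p x - q x) = 0"
    using assms by (simp add: ip_diff_right A2_diff)
  then show ?thesis by (simp add: ip_self)
qed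

text \<open>The functions \<open>ker1 z (t v)\<close> and \<open>t ker1 z v\<close> represent the same functional; they may be
  exchanged inside a norm.\<close>

lemma ker1_scaleR_diff:
  assumes "z \<in> D" "p \<in> A2"
  shows "norm_sq (\<lambda>x. p x - ker1 z (t *\<^sub>R v) x) = norm_sq (\<lambda>x. p x - of_real t * ker1 z v x)"
proof (rule of_real_eq_iff[where 'a = complex, THEN iffD1])
  have eq: "ip f (ker1 z (t *\<^sub>R v)) = ip f (\<lambda>x. of_real t * ker1 z v x)" if "f \<in> A2" for f
    using ip_ker1_scale(1)[OF assms(1) that, of "of_real t" v]
    by (simp add: of_real_cvec_scale ip_cmult_right)
  have eq': "ip (ker1 z (t *\<^sub>R v)) f = ip (\<lambda>x. of_real t * ker1 z v x) f" if "f \<in> A2" for f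
    by (subst (1 2) ip_commute) (simp add: eq that)
  show "complex_of_real (norm_sq (\<lambda>x. p x - ker1 z (t *\<^sub>R v) x))
      = of_real (norm_sq (\<lambda>x. p x - of_real t * ker1 z v x))"
    unfolding ip_self[symmetric]
    using assms by (simp add: ip_diff_left ip_diff_right eq eq' A2_intros ker1_A2)
qed

lemma ker2_scaleR_diff:
  assumes "z \<in> D" "p \<in> A2"
  shows "norm_sq (\<lambda>x. p x - ker2 z u (t *\<^sub>R v) x) = norm_sq (\<lambda>x. p x - of_real t * ker2 z u v x)"
proof (rule of_real_eq_iff[where 'a = complex, THEN iffD1])
  have eq': "ip (ker2 z u (t *\<^sub>R v)) f = ip (\<lambda>x. of_real t * ker2 z u v x) f" if "f \<in> A2" for f
    using ip_ker2_scale[OF assms(1) that, of u "of_real t" v]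
    by (simp add: of_real_cvec_scale ip_cmult_left)
  have eq: "ip f (ker2 z u (t *\<^sub>R v)) = ip f (\<lambda>x. of_real t * ker2 z u v x)" if "f \<in> A2" for f
    by (subst (1 2) ip_commute) (simp add: eq' that)
  show "complex_of_real (norm_sq (\<lambda>x. p x - ker2 z u (t *\<^sub>R v) x))
      = of_real (norm_sq (\<lambda>x. p x - of_real t * ker2 z u v x))"
    unfolding ip_self[symmetric]
    using assms by (simp add: ip_diff_left ip_diff_right eq eq' A2_intros ker2_A2)
qed

lemma
  assumes z: "z \<in> D"
  shows deriv_ip_ker_ker: "((\<lambda>t. ip (ker (z + t *\<^sub>R v)) (ker (z + t *\<^sub>R v))) has_vector_derivative
      ip (ker1 z v) (ker z) + ip (ker z) (ker1 z v)) (at 0)" (is ?A)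
    and deriv_ip_ker1_ker: "((\<lambda>t. ip (ker1 (z + t *\<^sub>R v) u) (ker (z + t *\<^sub>R v))) has_vector_derivative
      ip (ker2 z u v) (ker z) + ip (ker1 z u) (ker1 z v)) (at 0)" (is ?B)
proof -
  obtain s C where s: "s > 0" and C: "C \<ge> 0" and sub: "ball z s \<subseteq> D" and
    est: "\<And>y. y \<in> ball z s \<Longrightarrow> L2norm (\<lambda>x. ker y x - ker z x - ker1 z (y - z) x) \<le> C * (norm (y - z))\<^sup>2"
    "\<And>y u. y \<in> ball z s \<Longrightarrow>
      L2norm (\<lambda>x. ker1 y u x - ker1 z u x - ker2 z u (y - z) x) \<le> C * norm u * (norm (y - z))\<^sup>2"
    by (rule ker_estimates[OF z]) (rule that; assumption)
  define \<delta> where "\<delta> = s / (norm v + 1)"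
  have v1: "norm v + 1 > 0" by (simp add: add_nonneg_pos)
  have \<delta>: "\<delta> > 0" using s v1 by (simp add: \<delta>_def)
  have near: "z + t *\<^sub>R v \<in> ball z s" if "\<bar>t\<bar> < \<delta>" for t
  proof -
    have "\<bar>t\<bar> * (norm v + 1) < s" using that v1 by (simp add: \<delta>_def pos_less_divide_eq)
    moreover have "\<bar>t\<bar> * norm v \<le> \<bar>t\<bar> * (norm v + 1)" by (intro mult_left_mono) auto
    ultimately show ?thesis by (simp add: dist_norm)
  qed
  then have inD: "z + t *\<^sub>R v \<in> D" if "\<bar>t\<bar> < \<delta>" for t using that sub by blast
  define K where "K = C * (norm v)\<^sup>2 + C * norm u * (norm v)\<^sup>2"
  have K: "C * (norm v)\<^sup>2 \<le> K" "C * norm u * (norm v)\<^sup>2 \<le> K" using C by (auto simp: K_def)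
  have e1: "L2norm (\<lambda>x. ker (z + t *\<^sub>R v) x - ker (z + 0 *\<^sub>R v) x - of_real t * ker1 z v x) \<le> K * t\<^sup>2"
    if "\<bar>t\<bar> < \<delta>" for t
  proof -
    have "L2norm (\<lambda>x. ker (z + t *\<^sub>R v) x - ker z x - of_real t * ker1 z v x) \<le> C * (norm v)\<^sup>2 * t\<^sup>2"
      using est(1)[OF near[OF that]]
        ker1_scaleR_diff[OF z A2_diff[OF ker_A2[OF inD[OF that]] ker_A2[OF z]], of t v]
      by (simp add: power_mult_distrib mult_ac)
    also have "\<dots> \<le> K * t\<^sup>2" by (intro mult_right_mono K) simp
    finally show ?thesis by simp
  qed
  have e2: "L2norm (\<lambda>x. ker1 (z + t *\<^sub>R v) u x - ker1 (z + 0 *\<^sub>R v) u x - of_real t * ker2 z u v x)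
      \<le> K * t\<^sup>2" if "\<bar>t\<bar> < \<delta>" for t
  proof -
    have "L2norm (\<lambda>x. ker1 (z + t *\<^sub>R v) u x - ker1 z u x - of_real t * ker2 z u v x)
        \<le> C * norm u * (norm v)\<^sup>2 * t\<^sup>2"
      using est(2)[OF near[OF that], of u]
        ker2_scaleR_diff[OF z A2_diff[OF ker1_A2[OF inD[OF that]] ker1_A2[OF z]], of u u u t v]
      by (simp add: power_mult_distrib mult_ac)
    also have "\<dots> \<le> K * t\<^sup>2" by (intro mult_right_mono K) simp
    finally show ?thesis by simp
  qed
  show ?A
    using ip_has_vector_derivative[OF ker1_A2[OF z] ker1_A2[OF z] \<delta> ker_A2[OF inD] ker_A2[OF inD] e1 e1]
    by simp
  show ?B
    using ip_has_vector_derivative[OF ker2_A2[OF z] ker1_A2[OF z] \<delta> ker1_A2[OF inD] ker_A2[OF inD] e2 e1]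
    by simp
qed

lemma norm_sq_ker_pos:
  assumes "z \<in> D"
  shows "norm_sq (ker z) > 0"
proof -
  have "1 \<le> L2norm (\<lambda>x. 1) * L2norm (ker z)"
    using Cauchy_Schwarz[OF A2_const ker_A2[OF assms], of 1] by (simp add: ip_ker[OF assms A2_const])
  then have "norm_sq (ker z) \<noteq> 0" by auto
  then show ?thesis using norm_sq_nonneg[of "ker z"] by simp
qed

lemma bergman_kernel_diag:
  assumes "z \<in> D"
  shows "bergman_kernel D z z = of_real (norm_sq (ker z))"
  unfolding bergman_kernel_def ip_def[symmetric]
proof (rule the_equality)
  have "complex_of_real (norm_sq (ker z)) = ker z z"
    using ip_self[of "ker z"] ip_ker[OF assms ker_A2[OF assms]] by simp
  then show "\<exists>k\<in>A2. (\<forall>f\<in>A2. f z = ip f k) \<and> complex_of_real (norm_sq (ker z)) = k z"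
    using ker_A2[OF assms] ip_ker[OF assms] by (intro bexI[of _ "ker z"]) auto
  fix c assume "\<exists>k\<in>A2. (\<forall>f\<in>A2. f z = ip f k) \<and> c = k z"
  then obtain k where k: "k \<in> A2" "\<And>f. f \<in> A2 \<Longrightarrow> f z = ip f k" "c = k z" by blast
  obtain R where R: "R > 0" "ball z (2 * R) \<subseteq> D" using double_ball_inside[OF assms] .
  have "norm_sq (\<lambda>x. k x - ker z x) = 0"
    by (rule norm_sq_unique_diff) (use k ip_ker[OF assms] ker_A2[OF assms] in auto)
  then have "cmod (k z - ker z z) \<le> 0"
    using evaluation_bound[OF R, of z "\<lambda>x. k x - ker z x"] R(1) k(1) ker_A2[OF assms]
    by (simp add: A2_diff)
  then show "c = complex_of_real (norm_sq (ker z))"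
    using k(3) \<open>complex_of_real (norm_sq (ker z)) = ker z z\<close> by simp
qed

lemma log_kernel_eq: "z \<in> D \<Longrightarrow> log_kernel D z = of_real (ln (norm_sq (ker z)))"
  by (simp add: log_kernel_def bergman_kernel_diag)

lemma open_line: "open {t. z + t *\<^sub>R v \<in> D}"
proof -
  have "open ((\<lambda>t. z + t *\<^sub>R v) -` D)"
    by (rule open_vimage[OF open_D]) (intro continuous_intros)
  then show ?thesis by (simp add: vimage_def)
qed

lemma dir_deriv_transform:
  assumes "z \<in> D" "((\<lambda>t. g (z + t *\<^sub>R v)) has_vector_derivative d) (at 0)" "\<And>w. w \<in> D \<Longrightarrow> h w = g w"
  shows "dir_deriv v h z = d"
proof -
  have "((\<lambda>t. h (z + t *\<^sub>R v)) has_vector_derivative d) (at 0)"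
    by (rule has_vector_derivative_transform_within_open[OF assms(2) open_line[of z v]])
      (use assms in auto)
  then show ?thesis unfolding dir_deriv_def by (rule vector_derivative_at)
qed

text \<open>On \<open>D\<close> the function is \<open>ln \<langle>ker z, ker z\<rangle>\<close>, to which the product rule applies.\<close>

lemma dir_deriv_log_kernel:
  assumes z: "z \<in> D"
  shows "dir_deriv v (log_kernel D) z
    = (ip (ker1 z v) (ker z) + ip (ker z) (ker1 z v)) / of_real (norm_sq (ker z))"
proof (rule dir_deriv_transform[OF z _ log_kernel_eq])
  define d where "d = ip (ker1 z v) (ker z) + ip (ker z) (ker1 z v)"
  have d: "d = of_real (Re d)"
    unfolding d_def by (subst (2 4) ip_commute) (simp add: complex_add_cnj complex_eq_iff)
  have "((\<lambda>t. Re (ip (ker (z + t *\<^sub>R v)) (ker (z + t *\<^sub>R v)))) has_vector_derivative Re d) (at 0)"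
    unfolding d_def by (rule bounded_linear.has_vector_derivative[OF bounded_linear_Re deriv_ip_ker_ker[OF z]])
  then have "((\<lambda>t. norm_sq (ker (z + t *\<^sub>R v))) has_real_derivative Re d) (at 0)"
    by (simp add: ip_self has_real_derivative_iff_has_vector_derivative)
  then have "((\<lambda>t. ln (norm_sq (ker (z + t *\<^sub>R v)))) has_real_derivative
      1 / norm_sq (ker z) * Re d) (at 0)"
    using norm_sq_ker_pos[OF z] by (auto intro!: derivative_eq_intros)
  then have "((\<lambda>t. complex_of_real (ln (norm_sq (ker (z + t *\<^sub>R v))))) has_vector_derivative
      of_real (1 / norm_sq (ker z) * Re d)) (at 0)"
    by (simp only: has_real_derivative_iff_has_vector_derivative has_vector_derivative_of_real)
  moreover have "complex_of_real (1 / norm_sq (ker z) * Re d) = d / of_real (norm_sq (ker z))"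
    by (subst (2) d) simp
  ultimately show "((\<lambda>t. complex_of_real (ln (norm_sq (ker (z + t *\<^sub>R v))))) has_vector_derivative
      (ip (ker1 z v) (ker z) + ip (ker z) (ker1 z v)) / of_real (norm_sq (ker z))) (at 0)"
    by (simp only: d_def)
qed

text \<open>Since \<open>ker1 z\<close> is antilinear, \<open>\<langle>ker1 z v, ker z\<rangle>\<close> is the antilinear part of the derivative in
  direction \<open>v\<close>.\<close>

lemma wirtinger_bar_log_kernel:
  assumes z: "z \<in> D"
  shows "wirtinger_bar k (log_kernel D) z
    = ip (ker1 z (axis k 1)) (ker z) / ip (ker z) (ker z)"
  unfolding wirtinger_bar_def dir_deriv_log_kernel[OF z] axis_scale_one[of k \<i>]
    ip_ker1_scale[OF z ker_A2[OF z]] ip_self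
  by (simp add: algebra_simps flip: add_divide_distrib)

definition metric_coeff :: "complex ^ 'n \<Rightarrow> 'n \<Rightarrow> 'n \<Rightarrow> complex" where
  "metric_coeff z j k =
    (ip (ker1 z (axis k 1)) (ker1 z (axis j 1)) * ip (ker z) (ker z)
      - ip (ker1 z (axis k 1)) (ker z) * ip (ker z) (ker1 z (axis j 1))) / (ip (ker z) (ker z))\<^sup>2"

text \<open>The terms of the derivative in direction \<open>v\<close> in which \<open>v\<close> enters through the first argument of
  \<open>ip\<close>, among them the one with \<open>ker2\<close>, are antilinear in \<open>v\<close> and cancel.\<close>

lemma wirtinger_wirtinger_bar_log_kernel:
  assumes z: "z \<in> D"
  shows "wirtinger j (wirtinger_bar k (log_kernel D)) z = metric_coeff z j k"
proof -
  define N where "N = ip (ker z) (ker z)"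
  have N: "N \<noteq> 0" using norm_sq_ker_pos[OF z] by (simp add: N_def ip_self)
  define P where "P = ip (ker1 z (axis k 1)) (ker z)"
  have dd: "dir_deriv v (wirtinger_bar k (log_kernel D)) z =
      ((ip (ker2 z (axis k 1) v) (ker z) + ip (ker1 z (axis k 1)) (ker1 z v)) * N
        - P * (ip (ker1 z v) (ker z) + ip (ker z) (ker1 z v))) / (N * N)" for v
  proof (rule dir_deriv_transform[OF z _ wirtinger_bar_log_kernel])
    have "((\<lambda>t. ip (ker1 (z + t *\<^sub>R v) (axis k 1)) (ker (z + t *\<^sub>R v))
          / ip (ker (z + t *\<^sub>R v)) (ker (z + t *\<^sub>R v))) has_derivative
        (\<lambda>h. (h *\<^sub>R (ip (ker2 z (axis k 1) v) (ker z) + ip (ker1 z (axis k 1)) (ker1 z v)) * N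
          - P * (h *\<^sub>R (ip (ker1 z v) (ker z) + ip (ker z) (ker1 z v)))) / (N * N))) (at 0)"
      using has_derivative_divide'[OF
          deriv_ip_ker1_ker[OF z, of v "axis k 1", unfolded has_vector_derivative_def]
          deriv_ip_ker_ker[OF z, of v, unfolded has_vector_derivative_def]] N
      by (simp add: N_def P_def)
    then show "((\<lambda>t. ip (ker1 (z + t *\<^sub>R v) (axis k 1)) (ker (z + t *\<^sub>R v))
          / ip (ker (z + t *\<^sub>R v)) (ker (z + t *\<^sub>R v))) has_vector_derivative
        ((ip (ker2 z (axis k 1) v) (ker z) + ip (ker1 z (axis k 1)) (ker1 z v)) * N
        - P * (ip (ker1 z v) (ker z) + ip (ker z) (ker1 z v))) / (N * N)) (at 0)"
      unfolding has_vector_derivative_def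
      by (rule has_derivative_eq_rhs) (auto simp: scaleR_conv_of_real algebra_simps diff_divide_distrib add_divide_distrib)
  qed
  show ?thesis
    unfolding wirtinger_def dd axis_scale_one[of j \<i>] ip_ker1_scale[OF z ker_A2[OF z]]
      ip_ker1_scale[OF z ker1_A2[OF z]] ip_ker2_scale[OF z ker_A2[OF z]] metric_coeff_def
      N_def[symmetric] P_def[symmetric]
    using N by (simp add: field_simps power2_eq_square)
qed

lemma ip_ker1_sum:
  assumes "z \<in> D" "f \<in> A2"
  shows "ip f (ker1 z u) = (\<Sum>j\<in>UNIV. u $ j * ip f (ker1 z (axis j 1)))"
    "ip (ker1 z u) f = (\<Sum>j\<in>UNIV. cnj (u $ j) * ip (ker1 z (axis j 1)) f)"
proof -
  show *: "ip f (ker1 z u) = (\<Sum>j\<in>UNIV. u $ j * ip f (ker1 z (axis j 1)))"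
    by (simp add: ip_ker1 assms grad_apply_axis) (simp add: grad_apply_def mult.commute)
  show "ip (ker1 z u) f = (\<Sum>j\<in>UNIV. cnj (u $ j) * ip (ker1 z (axis j 1)) f)"
    by (subst (1 2) ip_commute) (simp add: *)
qed

lemma bergman_metric_coeff:
  assumes "z \<in> D"
  shows "bergman_metric D z u v =
    1/2 * (\<Sum>j\<in>UNIV. \<Sum>k\<in>UNIV. metric_coeff z j k * u $ j * cnj (v $ k))"
  by (simp add: bergman_metric_def wirtinger_wirtinger_bar_log_kernel[OF assms])

lemma bergman_metric_gram:
  assumes z: "z \<in> D"
  shows "bergman_metric D z u v =
    (ip (ker1 z v) (ker1 z u) * ip (ker z) (ker z) - ip (ker1 z v) (ker z) * ip (ker z) (ker1 z u))
      / (2 * (ip (ker z) (ker z))\<^sup>2)"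
proof -
  define N where "N = ip (ker z) (ker z)"
  have eq1: "ip (ker1 z v) (ker1 z u) = (\<Sum>j\<in>UNIV. \<Sum>k\<in>UNIV.
      ip (ker1 z (axis k 1)) (ker1 z (axis j 1)) * u $ j * cnj (v $ k))"
    unfolding ip_ker1_sum(1)[OF z ker1_A2[OF z], of v u]
    by (rule sum.cong[OF refl], subst ip_ker1_sum(2)[OF z ker1_A2[OF z], of v])
      (simp add: sum_distrib_left mult_ac)
  have eq2: "ip (ker1 z v) (ker z) * ip (ker z) (ker1 z u) = (\<Sum>j\<in>UNIV. \<Sum>k\<in>UNIV.
      ip (ker1 z (axis k 1)) (ker z) * ip (ker z) (ker1 z (axis j 1)) * u $ j * cnj (v $ k))"
    unfolding ip_ker1_sum(1)[OF z ker_A2[OF z], of u] ip_ker1_sum(2)[OF z ker_A2[OF z], of v]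
    by (subst mult.commute) (simp add: sum_product mult_ac)
  show ?thesis
    unfolding bergman_metric_coeff[OF z] metric_coeff_def eq1 eq2 N_def[symmetric]
    by (simp add: sum_divide_distrib sum_distrib_left sum_distrib_right sum_subtractf[symmetric]
        diff_divide_distrib algebra_simps)
qed

text \<open>The vector \<open>q\<close> below is the component of the representer of \<open>f \<mapsto> \<nabla>f(z)u\<close> orthogonal
  to the kernel function. It still represents that functional on functions vanishing at \<open>z\<close>.\<close>

lemma
  assumes z: "z \<in> D"
  shows bergman_metric_nonneg: "Re (bergman_metric D z u u) \<ge> 0"
    and derivative_le_bergman_norm: "g \<in> A2 \<Longrightarrow> g z = 0 \<Longrightarrow>
      (cmod (grad_apply g z u))\<^sup>2 \<le> norm_sq g * (2 * norm_sq (ker z) * (bergman_norm D z u)\<^sup>2)"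
proof -
  define N where "N = norm_sq (ker z)"
  have N: "N > 0" using norm_sq_ker_pos[OF z] by (simp add: N_def)
  define p where "p = ip (ker1 z u) (ker z)"
  define c where "c = p / of_real N"
  define q where "q = (\<lambda>x. ker1 z u x - c * ker z x)"
  have q: "q \<in> A2" unfolding q_def by (intro A2_intros ker1_A2 ker_A2 z)
  have cp: "cnj c * p = of_real ((cmod p)\<^sup>2 / N)"
    using complex_norm_square[of p] by (simp add: c_def mult.commute)
  have "norm_sq q = norm_sq (ker1 z u) - 2 * Re (cnj c * p) + (cmod c)\<^sup>2 * N"
    unfolding q_def N_def p_def by (rule norm_sq_diff_cmult[OF ker1_A2[OF z] ker_A2[OF z]])
  also have "(cmod c)\<^sup>2 * N = (cmod p)\<^sup>2 / N"
    using N by (simp add: c_def norm_divide power_divide power2_eq_square)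
  finally have nq: "norm_sq q = norm_sq (ker1 z u) - (cmod p)\<^sup>2 / N"
    unfolding cp by simp
  have "ip (ker z) (ker1 z u) = cnj p" unfolding p_def by (rule ip_commute)
  then have "bergman_metric D z u u
      = (of_real (norm_sq (ker1 z u)) * of_real N - p * cnj p) / (2 * (of_real N)\<^sup>2)"
    by (simp add: bergman_metric_gram[OF z] ip_self N_def p_def)
  also have "\<dots> = of_real ((norm_sq (ker1 z u) * N - (cmod p)\<^sup>2) / (2 * N\<^sup>2))"
    by (simp add: complex_norm_square[of p, symmetric] del: of_real_power)
      (simp add: of_real_power)
  also have "(norm_sq (ker1 z u) * N - (cmod p)\<^sup>2) / (2 * N\<^sup>2) = norm_sq q / (2 * N)"
    using N by (simp add: nq field_simps power2_eq_square)
  finally have H: "Re (bergman_metric D z u u) = norm_sq q / (2 * N)" by simp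
  then show *: "Re (bergman_metric D z u u) \<ge> 0" using N norm_sq_nonneg[of q] by simp
  then have nq2: "norm_sq q = 2 * N * (bergman_norm D z u)\<^sup>2"
    using H N by (simp add: bergman_norm_def)
  assume g: "g \<in> A2" "g z = 0"
  have "ip g q = grad_apply g z u"
    unfolding q_def using g z
    by (simp add: ip_diff_right ip_cmult_right A2_intros ker1_A2 ker_A2 ip_ker1 ip_ker)
  then show "(cmod (grad_apply g z u))\<^sup>2 \<le> norm_sq g * (2 * norm_sq (ker z) * (bergman_norm D z u)\<^sup>2)"
    using Cauchy_Schwarz_sq[OF g(1) q] by (simp add: nq2 N_def)
qed

lemma bergman_norm_nonneg: "z \<in> D \<Longrightarrow> bergman_norm D z u \<ge> 0"
  by (simp add: bergman_norm_def bergman_metric_nonneg)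

text \<open>The test function \<open>x \<mapsto> \<langle>x - z, u\<rangle> K(x, z)\<close> vanishes at \<open>z\<close> and has norm at most
  \<open>B |u| K(z, z)\<^sup>1\<^sup>/\<^sup>2\<close>, where \<open>B\<close> bounds the diameter of \<open>D\<close>.\<close>

lemma bergman_norm_lower_bound:
  assumes z: "z \<in> D" and B: "\<And>x. x \<in> D \<Longrightarrow> norm (x - z) \<le> B"
  shows "norm u \<le> sqrt 2 * B * bergman_norm D z u"
proof (cases "u = 0")
  case False
  define N where "N = norm_sq (ker z)"
  have N: "N > 0" using norm_sq_ker_pos[OF z] by (simp add: N_def)
  define l where "l = (\<lambda>x. \<Sum>i\<in>UNIV. cnj (u $ i) * (x $ i - z $ i))"
  have B0: "B \<ge> 0" using B[OF z] by simp
  have der: "(l has_derivative (\<lambda>h. \<Sum>i\<in>UNIV. cnj (u $ i) * h $ i)) (at x)" for x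
    unfolding l_def
    by (auto intro!: derivative_eq_intros bounded_linear_imp_has_derivative bounded_linear_vec_nth)
  have lin: "(\<Sum>i\<in>UNIV. cnj (u $ i) * (c *s h) $ i) = c * (\<Sum>i\<in>UNIV. cnj (u $ i) * h $ i)" for c h
    by (simp add: sum_distrib_left mult_ac)
  have hol: "holomorphic_scv D l"
    unfolding holomorphic_scv_def by (intro ballI exI conjI, rule der) (simp only: lin, simp)
  have norm_u: "(\<Sum>i\<in>UNIV. cnj (u $ i) * u $ i) = of_real ((norm u)\<^sup>2)"
  proof -
    have "(norm u)\<^sup>2 = (\<Sum>i\<in>UNIV. (cmod (u $ i))\<^sup>2)"
      by (simp add: norm_vec_def L2_set_def sum_nonneg)
    then show ?thesis
      by (simp add: complex_norm_square mult.commute del: of_real_power)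
  qed
  have grad_l: "grad_apply l z u = of_real ((norm u)\<^sup>2)"
    unfolding grad_apply_eq[OF der lin] norm_u ..
  have bnd: "cmod (l x) \<le> norm u * B" if "x \<in> D" for x
  proof -
    have "cmod (l x) \<le> (\<Sum>i\<in>UNIV. \<bar>cmod (u $ i)\<bar> * \<bar>cmod ((x - z) $ i)\<bar>)"
      unfolding l_def by (rule order_trans[OF norm_sum]) (simp add: norm_mult)
    also have "\<dots> \<le> norm u * norm (x - z)"
      unfolding norm_vec_def by (rule L2_set_mult_ineq)
    also have "\<dots> \<le> norm u * B" by (intro mult_left_mono B that) simp
    finally show ?thesis .
  qed
  define g where "g = (\<lambda>x. l x * ker z x)"
  have g: "g \<in> A2" and ng: "norm_sq g \<le> (norm u * B)\<^sup>2 * N"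
    unfolding g_def N_def using A2_bounded_mult[OF ker_A2[OF z] hol bnd] by auto
  have "l z = 0" by (simp add: l_def)
  moreover have "ker z z = of_real N"
    using ip_self[of "ker z"] ip_ker[OF z ker_A2[OF z]] by (simp add: N_def)
  ultimately have "g z = 0" "grad_apply g z u = of_real ((norm u)\<^sup>2 * N)"
    using grad_apply_mult[OF hol A2_holomorphic[OF ker_A2[OF z]] z, of u]
    by (auto simp: g_def grad_l)
  then have "((norm u)\<^sup>2 * N)\<^sup>2 \<le> norm_sq g * (2 * N * (bergman_norm D z u)\<^sup>2)"
    using derivative_le_bergman_norm[OF z g, of u] N by (simp add: N_def norm_mult power_mult_distrib norm_power)
  also have "\<dots> \<le> ((norm u * B)\<^sup>2 * N) * (2 * N * (bergman_norm D z u)\<^sup>2)"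
    using N by (intro mult_right_mono ng) auto
  also have "\<dots> = (norm u * N)\<^sup>2 * (sqrt 2 * B * bergman_norm D z u)\<^sup>2"
    by (simp add: power_mult_distrib power2_eq_square mult_ac)
  finally have "(norm u * N)\<^sup>2 * (norm u)\<^sup>2 \<le> (norm u * N)\<^sup>2 * (sqrt 2 * B * bergman_norm D z u)\<^sup>2"
    by (simp add: power2_eq_square mult_ac)
  then have "(norm u)\<^sup>2 \<le> (sqrt 2 * B * bergman_norm D z u)\<^sup>2"
    using False N by (simp add: mult_le_cancel_left)
  then show ?thesis
    by (rule power2_le_imp_le) (use B0 bergman_norm_nonneg[OF z] in simp)
qed (use B[OF z] bergman_norm_nonneg[OF z] in simp)

lemma isCont_metric_coeff: "z \<in> D \<Longrightarrow> isCont (\<lambda>w. metric_coeff w j k) z"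
  unfolding metric_coeff_def using norm_sq_ker_pos[of z]
  by (intro continuous_intros continuous_ip_ker_ker continuous_ip_ker1_ker continuous_ip_ker_ker1
      continuous_ip_ker1_ker1) (auto simp: ip_self)

lemma continuous_on_bergman_norm:
  assumes "continuous_on T \<gamma>" "continuous_on T v" "\<And>t. t \<in> T \<Longrightarrow> \<gamma> t \<in> D"
  shows "continuous_on T (\<lambda>t. bergman_norm D (\<gamma> t) (v t))"
proof -
  have "continuous_on D (\<lambda>w. metric_coeff w j k)" for j k
    by (intro continuous_at_imp_continuous_on ballI isCont_metric_coeff)
  then have "continuous_on T (\<lambda>t. metric_coeff (\<gamma> t) j k)" for j k
    by (rule continuous_on_compose2) (use assms in auto)
  then have "continuous_on T (\<lambda>t. sqrt (Re (1/2 * (\<Sum>j\<in>UNIV. \<Sum>k\<in>UNIV.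
      metric_coeff (\<gamma> t) j k * v t $ j * cnj (v t $ k)))))"
    by (intro continuous_intros assms)
  then show ?thesis
    by (rule continuous_on_eq) (simp add: bergman_norm_def bergman_metric_coeff assms)
qed

lemma bergman_norm_scaleR:
  assumes "z \<in> D"
  shows "bergman_norm D z (t *\<^sub>R u) = \<bar>t\<bar> * bergman_norm D z u"
proof -
  have "bergman_metric D z (t *\<^sub>R u) (t *\<^sub>R u) = of_real (t\<^sup>2) * bergman_metric D z u u"
    by (simp add: bergman_metric_def sum_distrib_left scaleR_conv_of_real[where 'a = complex] power2_eq_square mult_ac)
  then show ?thesis by (simp add: bergman_norm_def real_sqrt_mult)
qed

end

section \<open>Lengths of curves\<close>

lemma polynomial_function_piecewise_smooth:
  fixes \<gamma> :: "real \<Rightarrow> complex ^ 'n"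
  assumes "polynomial_function \<gamma>"
  shows "piecewise_smooth \<gamma>"
proof -
  have "\<exists>g. (polynomial_function (g 0) \<and> g 0 = \<gamma>) \<and>
      (\<forall>n. polynomial_function (g (Suc n)) \<and> (\<forall>t. (g n has_vector_derivative g (Suc n) t) (at t)))"
  proof -
    have step: "\<exists>q. polynomial_function q \<and> (\<forall>t. (p has_vector_derivative q t) (at t))"
      if "polynomial_function p" for p :: "real \<Rightarrow> complex ^ 'n"
      using has_vector_derivative_polynomial_function[OF that] by blast
    have "\<exists>g. \<forall>n. (polynomial_function (g n) \<and> (n = 0 \<longrightarrow> g n = \<gamma>)) \<and>
        (\<forall>t. (g n has_vector_derivative g (Suc n) t) (at t))"
      by (rule dependent_nat_choice) (use assms step in auto)
    then show ?thesis by blast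
  qed
  then obtain g where "g 0 = \<gamma>" "\<And>n t. (g n has_vector_derivative g (Suc n) t) (at t)" by blast
  then have "smooth_on_interval 0 1 \<gamma>"
    unfolding smooth_on_interval_def
    by (intro exI[of _ g]) (auto intro: has_vector_derivative_at_within)
  then show ?thesis
    unfolding piecewise_smooth_def
    using assms continuous_on_polymonial_function by (intro conjI exI[of _ "{0, 1}"]) auto
qed

text \<open>Between two consecutive break points the velocity extends continuously to the closed
  interval.\<close>

lemma smooth_on_interval_velocity:
  assumes "smooth_on_interval a b \<gamma>"
  obtains v where "continuous_on {a..b} v"
    "\<And>t. t \<in> {a<..<b} \<Longrightarrow> (\<gamma> has_vector_derivative v t) (at t)"
proof -
  obtain g where g0: "\<And>t. t \<in> {a..b} \<Longrightarrow> g 0 t = \<gamma> t" and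
    g: "\<And>m t. t \<in> {a..b} \<Longrightarrow> (g m has_vector_derivative g (Suc m) t) (at t within {a..b})"
    using assms unfolding smooth_on_interval_def by blast
  show ?thesis
  proof (rule that)
    show "continuous_on {a..b} (g 1)"
      using g[of _ 1] has_vector_derivative_continuous continuous_on_eq_continuous_within by blast
    fix t assume t: "t \<in> {a<..<b}"
    then have "(g 0 has_vector_derivative g (Suc 0) t) (at t)"
      using g[of t 0] by (simp add: at_within_Icc_at)
    then show "(\<gamma> has_vector_derivative g 1 t) (at t)"
      by (simp, rule has_vector_derivative_transform_within_open[of "g 0" _ t "{a<..<b}"])
        (use t g0 in auto)
  qed
qed

context
  fixes \<gamma> :: "real \<Rightarrow> complex ^ 'n" and S
  assumes S: "finite S" "{0, 1} \<subseteq> S" "S \<subseteq> {0..1}"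
    and smooth: "\<And>a b. a \<in> S \<Longrightarrow> b \<in> S \<Longrightarrow> a < b \<Longrightarrow> S \<inter> {a<..<b} = {} \<Longrightarrow> smooth_on_interval a b \<gamma>"
begin

lemma predecessor:
  assumes "t \<in> {0<..1}"
  obtains p where "p \<in> S" "p < t" "S \<inter> {p<..<t} = {}"
proof -
  define A where "A = {s \<in> S. s < t}"
  have A: "finite A" "A \<noteq> {}" using S assms by (auto simp: A_def)
  have "Max A \<in> A" using A by (rule Max_in)
  moreover have "S \<inter> {Max A<..<t} = {}"
  proof -
    have "x \<le> Max A" if "x \<in> S" "x < t" for x
      using Max_ge[OF A(1), of x] that by (simp add: A_def)
    then show ?thesis by force
  qed
  ultimately show ?thesis using that by (auto simp: A_def)
qed

lemma successor:
  assumes "t \<in> {0..<1}"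
  obtains p where "p \<in> S" "t < p" "S \<inter> {t<..<p} = {}"
proof -
  define A where "A = {s \<in> S. t < s}"
  have A: "finite A" "A \<noteq> {}" using S assms by (auto simp: A_def)
  have "Min A \<in> A" using A by (rule Min_in)
  moreover have "S \<inter> {t<..<Min A} = {}"
  proof -
    have "Min A \<le> x" if "x \<in> S" "t < x" for x
      using Min_le[OF A(1), of x] that by (simp add: A_def)
    then show ?thesis by force
  qed
  ultimately show ?thesis using that by (auto simp: A_def)
qed

lemma smooth_pieces_differentiable:
  assumes "t \<in> {0<..<1} - S"
  shows "(\<gamma> has_vector_derivative vector_derivative \<gamma> (at t)) (at t)"
proof -
  obtain a where a: "a \<in> S" "a < t" "S \<inter> {a<..<t} = {}" using predecessor[of t] assms by auto
  obtain b where b: "b \<in> S" "t < b" "S \<inter> {t<..<b} = {}" using successor[of t] assms by auto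
  have "S \<inter> {a<..<b} = {}"
  proof (rule equals0I)
    fix x assume "x \<in> S \<inter> {a<..<b}"
    then show False using a(3) b(3) assms by (cases x t rule: linorder_cases) auto
  qed
  then have "smooth_on_interval a b \<gamma>" using a b by (intro smooth) auto
  then obtain v where "(\<gamma> has_vector_derivative v t) (at t)"
    using smooth_on_interval_velocity a(2) b(2) by (metis greaterThanLessThan_iff)
  then show ?thesis using vector_derivative_at by force
qed

lemma smooth_pieces_integrable:
  assumes piece: "\<And>a b. a \<in> S \<Longrightarrow> b \<in> S \<Longrightarrow> a < b \<Longrightarrow> S \<inter> {a<..<b} = {} \<Longrightarrow> F integrable_on {a..b}"
  shows "(F :: real \<Rightarrow> real) integrable_on {0..1}"
proof -
  have "F integrable_on {0..t}" if "t \<in> S" for t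
    using that
  proof (induction "card {s \<in> S. s < t}" arbitrary: t rule: less_induct)
    case less
    show ?case
    proof (cases "t = 0")
      case False
      then have "t \<in> {0<..1}" using S(3) less.prems by force
      then obtain p where p: "p \<in> S" "p < t" "S \<inter> {p<..<t} = {}" by (rule predecessor)
      have "{s \<in> S. s < p} \<subset> {s \<in> S. s < t}" using p by auto
      then have "card {s \<in> S. s < p} < card {s \<in> S. s < t}"
        using S(1) by (intro psubset_card_mono) auto
      then have "F integrable_on {0..p}" using less.hyps p(1) by blast
      moreover have "F integrable_on {p..t}" using p less.prems by (intro piece) auto
      moreover have "0 \<le> p" using p(1) S(3) by auto
      ultimately show ?thesis
        using p(2) by (intro Henstock_Kurzweil_Integration.integrable_combine[of 0 p t]) auto
    qed (use integrable_on_refl[of F 0] in simp)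
  qed
  then show ?thesis using S(2) by auto
qed

end

context bounded_open_set begin

lemma bergman_speed_integrable:
  assumes "piecewise_smooth \<gamma>" "\<gamma> ` {0..1} \<subseteq> D"
  shows "(\<lambda>t. bergman_norm D (\<gamma> t) (vector_derivative \<gamma> (at t))) integrable_on {0..1}"
proof -
  obtain S where cont: "continuous_on {0..1} \<gamma>" and S: "finite S" "{0, 1} \<subseteq> S" "S \<subseteq> {0..1}"
    and smooth: "\<And>a b. a \<in> S \<Longrightarrow> b \<in> S \<Longrightarrow> a < b \<Longrightarrow> S \<inter> {a<..<b} = {} \<Longrightarrow> smooth_on_interval a b \<gamma>"
    using assms(1) unfolding piecewise_smooth_def by metis
  show ?thesis
  proof (rule smooth_pieces_integrable[OF S smooth])
    fix a b assume ab: "a \<in> S" "b \<in> S" "a < b" "S \<inter> {a<..<b} = {}"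
    then have sub: "{a..b} \<subseteq> {0..1}" using S(3) by auto
    obtain v where v: "continuous_on {a..b} v"
      "\<And>t. t \<in> {a<..<b} \<Longrightarrow> (\<gamma> has_vector_derivative v t) (at t)"
      by (rule smooth_on_interval_velocity[OF smooth[OF ab]]) (rule that; assumption)
    have "continuous_on {a..b} (\<lambda>t. bergman_norm D (\<gamma> t) (v t))"
      using assms(2) sub v(1)
      by (intro continuous_on_bergman_norm continuous_on_subset[OF cont]) auto
    then have "(\<lambda>t. bergman_norm D (\<gamma> t) (v t)) integrable_on {a..b}"
      by (rule integrable_continuous_interval)
    then show "(\<lambda>t. bergman_norm D (\<gamma> t) (vector_derivative \<gamma> (at t))) integrable_on {a..b}"
      by (rule integrable_spike[where S = "{a, b}"])
        (auto simp: vector_derivative_at[OF v(2)])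
  qed
qed

lemma bergman_length_nonneg:
  assumes "piecewise_smooth \<gamma>" "\<gamma> ` {0..1} \<subseteq> D"
  shows "bergman_length D \<gamma> \<ge> 0"
  unfolding bergman_length_def
  by (rule integral_nonneg[OF bergman_speed_integrable[OF assms]])
    (use assms(2) in \<open>auto intro!: bergman_norm_nonneg\<close>)

lemma increment_le_bergman_length:
  assumes hol: "holomorphic_scv D f"
    and bnd: "\<And>z u. z \<in> D \<Longrightarrow> cmod (grad_apply f z u) \<le> \<beta> * bergman_norm D z u"
    and \<gamma>: "piecewise_smooth \<gamma>" "\<gamma> ` {0..1} \<subseteq> D"
  shows "cmod (f (\<gamma> 1) - f (\<gamma> 0)) \<le> \<beta> * bergman_length D \<gamma>"
proof -
  obtain S where cont: "continuous_on {0..1} \<gamma>" and S: "finite S" "{0, 1} \<subseteq> S" "S \<subseteq> {0..1}"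
    and smooth: "\<And>a b. a \<in> S \<Longrightarrow> b \<in> S \<Longrightarrow> a < b \<Longrightarrow> S \<inter> {a<..<b} = {} \<Longrightarrow> smooth_on_interval a b \<gamma>"
    using \<gamma>(1) unfolding piecewise_smooth_def by metis
  let ?v = "\<lambda>t. vector_derivative \<gamma> (at t)"
  have int: "((\<lambda>t. grad_apply f (\<gamma> t) (?v t)) has_integral f (\<gamma> 1) - f (\<gamma> 0)) {0..1}"
  proof (rule fundamental_theorem_of_calculus_interior_strong[OF S(1), where f = "\<lambda>t. f (\<gamma> t)"])
    fix t assume t: "t \<in> {0<..<1} - S"
    have "(\<gamma> has_vector_derivative ?v t) (at t)"
      by (rule smooth_pieces_differentiable[OF S smooth t])
    moreover have "(f has_derivative grad_apply f (\<gamma> t)) (at (\<gamma> t))"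
      by (rule holomorphic_scv_derivative[OF hol]) (use \<gamma>(2) t in auto)
    ultimately show "((\<lambda>t. f (\<gamma> t)) has_vector_derivative grad_apply f (\<gamma> t) (?v t)) (at t)"
      unfolding has_vector_derivative_def
      by (rule has_derivative_eq_rhs[OF has_derivative_compose]) (simp add: grad_apply_scaleR)
  qed (use \<gamma>(2) in \<open>auto intro!: continuous_on_compose2[OF holomorphic_scv_continuous_on[OF hol]] cont\<close>)
  have pointwise: "cmod (grad_apply f (\<gamma> t) (?v t)) \<le> \<beta> * bergman_norm D (\<gamma> t) (?v t)"
    if "t \<in> {0..1}" for t
    by (rule bnd) (use \<gamma>(2) that in blast)
  have "cmod (integral {0..1} (\<lambda>t. grad_apply f (\<gamma> t) (?v t)))
      \<le> integral {0..1} (\<lambda>t. \<beta> * bergman_norm D (\<gamma> t) (?v t))"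
    by (rule integral_norm_bound_integral)
      (use int bergman_speed_integrable[OF \<gamma>] pointwise in \<open>auto intro: integrable_on_mult_right\<close>)
  then show ?thesis
    using int by (simp add: integral_unique bergman_length_def)
qed

lemma bergman_dist_le_length:
  assumes "piecewise_smooth \<gamma>" "\<gamma> ` {0..1} \<subseteq> D"
  shows "bergman_dist D (\<gamma> 0) (\<gamma> 1) \<le> bergman_length D \<gamma>"
  unfolding bergman_dist_def
proof (rule cInf_lower)
  show "bdd_below {bergman_length D \<delta> |\<delta>.
      piecewise_smooth \<delta> \<and> \<delta> ` {0..1} \<subseteq> D \<and> \<delta> 0 = \<gamma> 0 \<and> \<delta> 1 = \<gamma> 1}"
    by (rule bdd_belowI[of _ 0]) (auto intro: bergman_length_nonneg)
qed (use assms in blast)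

text \<open>Short segments show that the Bergman distance is infinitesimally at most the Bergman norm.\<close>

lemma bergman_norm_bound_if_lipschitz:
  assumes hol: "holomorphic_scv D f" and z: "z \<in> D" and L: "L \<ge> 0"
    and lip: "\<And>w. w \<in> D \<Longrightarrow> cmod (f z - f w) \<le> L * bergman_dist D z w"
  shows "cmod (grad_apply f z u) \<le> L * bergman_norm D z u"
proof (rule field_le_epsilon)
  fix e :: real assume e: "e > 0"
  \<comment> \<open>\<open>L + 1\<close> instead of \<open>L\<close>, which may be 0\<close>
  define \<epsilon> where "\<epsilon> = e / (L + 1)"
  have \<epsilon>: "\<epsilon> > 0" "L * \<epsilon> \<le> e" using e L by (simp_all add: \<epsilon>_def field_simps)
  define c where "c = bergman_norm D z u"
  define T where "T = {t. z + t *\<^sub>R u \<in> D}"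
  have "open T" unfolding T_def by (rule open_line)
  have T0: "0 \<in> T" using z by (simp add: T_def)
  have "continuous_on T (\<lambda>t. bergman_norm D (z + t *\<^sub>R u) u)"
    by (intro continuous_on_bergman_norm continuous_intros) (simp add: T_def)
  then have "isCont (\<lambda>t. bergman_norm D (z + t *\<^sub>R u) u) 0"
    using \<open>open T\<close> T0 by (simp add: continuous_on_eq_continuous_at)
  then have "((\<lambda>t. bergman_norm D (z + t *\<^sub>R u) u) \<longlongrightarrow> c) (at 0)"
    by (simp add: isCont_def c_def)
  then have "\<forall>\<^sub>F t in at 0. bergman_norm D (z + t *\<^sub>R u) u < c + \<epsilon>"
    by (rule order_tendstoD) (use \<epsilon> in simp)
  then have "\<forall>\<^sub>F t in nhds 0. t \<in> T \<and> bergman_norm D (z + t *\<^sub>R u) u < c + \<epsilon>"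
    using \<epsilon> eventually_nhds_in_open[OF \<open>open T\<close> T0]
    by (auto simp: eventually_at_filter c_def elim: eventually_elim2)
  then obtain d where d: "d > 0" "\<And>t. \<bar>t\<bar> < d \<Longrightarrow> t \<in> T \<and> bergman_norm D (z + t *\<^sub>R u) u < c + \<epsilon>"
    unfolding eventually_nhds_metric by (auto simp: dist_norm)
  have inc: "cmod ((f (z + of_real t *s u) - f z) / of_real t) \<le> L * (c + \<epsilon>)" if t: "t > 0" "t < d" for t
  proof -
    define \<gamma> where "\<gamma> = (\<lambda>s. z + s *\<^sub>R (t *\<^sub>R u))"
    have st: "\<bar>s * t\<bar> < d" if "s \<in> {0..1}" for s
    proof -
      have "s * t \<le> 1 * t" using that t by (intro mult_right_mono) auto
      moreover have "0 \<le> s * t" using that t by simp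
      ultimately show ?thesis using t(2) by linarith
    qed
    have "polynomial_function \<gamma>"
      unfolding \<gamma>_def
      by (intro polynomial_function_add polynomial_function_const polynomial_function_bounded_linear
          bounded_linear_scaleR_left)
    then have smooth: "piecewise_smooth \<gamma>" by (rule polynomial_function_piecewise_smooth)
    have inD: "\<gamma> ` {0..1} \<subseteq> D" using d(2)[OF st] by (auto simp: \<gamma>_def T_def)
    have "(\<gamma> has_vector_derivative t *\<^sub>R u) (at s)" for s
      unfolding \<gamma>_def by (auto intro!: derivative_eq_intros simp: has_vector_derivative_def)
    then have vd: "vector_derivative \<gamma> (at s) = t *\<^sub>R u" for s by (rule vector_derivative_at)
    have "bergman_length D \<gamma> \<le> integral {0..1} (\<lambda>s::real. t * (c + \<epsilon>))"
      unfolding bergman_length_def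
    proof (rule integral_le[OF bergman_speed_integrable[OF smooth inD]])
      fix s :: real assume s: "s \<in> {0..1}"
      then have "\<gamma> s \<in> D" using inD by blast
      then have "bergman_norm D (\<gamma> s) (vector_derivative \<gamma> (at s)) = t * bergman_norm D (\<gamma> s) u"
        using t by (simp add: vd bergman_norm_scaleR)
      also have "\<dots> \<le> t * (c + \<epsilon>)"
        using d(2)[OF st[OF s]] t by (intro mult_left_mono) (auto simp: \<gamma>_def)
      finally show "bergman_norm D (\<gamma> s) (vector_derivative \<gamma> (at s)) \<le> t * (c + \<epsilon>)" .
    qed auto
    then have "bergman_dist D z (z + t *\<^sub>R u) \<le> t * (c + \<epsilon>)"
      using bergman_dist_le_length[OF smooth inD] by (simp add: \<gamma>_def)
    moreover have "z + t *\<^sub>R u \<in> D" using d(2)[of t] t by (simp add: T_def)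
    ultimately have "cmod (f z - f (z + t *\<^sub>R u)) \<le> L * (t * (c + \<epsilon>))"
      using lip mult_left_mono[OF _ L] order_trans by blast
    then show ?thesis
      using t by (simp add: of_real_cvec_scale norm_divide norm_minus_commute divide_le_eq mult_ac)
  qed
  have "((\<lambda>h. (f (z + h *s u) - f z) / h) \<longlongrightarrow> grad_apply f z u) (at 0)"
    using has_field_derivative_complex_line[OF hol, of z 0 u] z by (simp add: DERIV_def)
  moreover have "filterlim complex_of_real (at 0) (at_right 0)"
    by (rule filterlim_atI)
      (auto intro!: tendsto_eq_intros simp: eventually_at_right_less eventually_at_filter)
  ultimately have "((\<lambda>t. (f (z + of_real t *s u) - f z) / of_real t) \<longlongrightarrow> grad_apply f z u) (at_right 0)"
    by (rule filterlim_compose)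
  then have "((\<lambda>t. cmod ((f (z + of_real t *s u) - f z) / of_real t)) \<longlongrightarrow> cmod (grad_apply f z u)) (at_right 0)"
    by (rule tendsto_norm)
  moreover have "\<forall>\<^sub>F t in at_right 0. cmod ((f (z + of_real t *s u) - f z) / of_real t) \<le> L * (c + \<epsilon>)"
    unfolding eventually_at_right_field using inc d(1) by blast
  ultimately have "cmod (grad_apply f z u) \<le> L * (c + \<epsilon>)"
    by (rule tendsto_upperbound) simp
  also have "\<dots> \<le> L * bergman_norm D z u + e" using \<epsilon>(2) by (simp add: c_def distrib_left)
  finally show "cmod (grad_apply f z u) \<le> L * bergman_norm D z u + e" .
qed

end

locale bounded_domain = bounded_open_set D for D :: "(complex ^ 'n) set" +
  assumes connected_D: "connected D"
begin

lemma curve_exists: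
  assumes "z \<in> D" "w \<in> D"
  shows "\<exists>\<gamma>. piecewise_smooth \<gamma> \<and> \<gamma> ` {0..1} \<subseteq> D \<and> \<gamma> 0 = z \<and> \<gamma> 1 = w"
  using connected_open_polynomial_connected[OF open_D connected_D assms]
    polynomial_function_piecewise_smooth
  unfolding path_image_def pathstart_def pathfinish_def by blast

text \<open>A connected open set is connected by polynomial curves, so the infimum is over a nonempty set.\<close>

lemma bergman_dist_greatest:
  assumes "z \<in> D" "w \<in> D"
    and "\<And>\<gamma>. piecewise_smooth \<gamma> \<Longrightarrow> \<gamma> ` {0..1} \<subseteq> D \<Longrightarrow> \<gamma> 0 = z \<Longrightarrow> \<gamma> 1 = w \<Longrightarrow> c \<le> bergman_length D \<gamma>"
  shows "c \<le> bergman_dist D z w"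
  unfolding bergman_dist_def
  by (rule cInf_greatest) (use curve_exists[OF assms(1,2)] assms(3) in auto)

lemma bergman_dist_nonneg: "z \<in> D \<Longrightarrow> w \<in> D \<Longrightarrow> bergman_dist D z w \<ge> 0"
  by (rule bergman_dist_greatest) (auto intro: bergman_length_nonneg)

lemma lipschitz_if_bergman_norm_bound:
  assumes hol: "holomorphic_scv D f"
    and bnd: "\<And>z u. z \<in> D \<Longrightarrow> cmod (grad_apply f z u) \<le> \<beta> * bergman_norm D z u"
    and \<beta>: "\<beta> \<ge> 0" and zw: "z \<in> D" "w \<in> D"
  shows "cmod (f z - f w) \<le> \<beta> * bergman_dist D z w"
proof (cases "\<beta> = 0")
  case True
  obtain \<gamma> where "piecewise_smooth \<gamma>" "\<gamma> ` {0..1} \<subseteq> D" "\<gamma> 0 = z" "\<gamma> 1 = w"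
    using curve_exists[OF zw] by blast
  then show ?thesis
    using increment_le_bergman_length[OF hol bnd, of \<gamma>] True by (simp add: norm_minus_commute)
next
  case False
  then have "\<beta> > 0" using \<beta> by simp
  have "cmod (f z - f w) / \<beta> \<le> bergman_dist D z w"
  proof (rule bergman_dist_greatest[OF zw])
    fix \<gamma> assume "piecewise_smooth \<gamma>" "\<gamma> ` {0..1} \<subseteq> D" "\<gamma> 0 = z" "\<gamma> 1 = w"
    then have "cmod (f z - f w) \<le> \<beta> * bergman_length D \<gamma>"
      using increment_le_bergman_length[OF hol bnd, of \<gamma>] by (simp add: norm_minus_commute)
    then show "cmod (f z - f w) / \<beta> \<le> bergman_length D \<gamma>"
      using \<open>\<beta> > 0\<close> by (simp add: divide_le_eq mult.commute)
  qed
  then show ?thesis using \<open>\<beta> > 0\<close> by (simp add: divide_le_eq mult.commute)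
qed

lemma norm_le_const_bergman_norm:
  obtains c where "c > 0" "\<And>z u. z \<in> D \<Longrightarrow> norm u \<le> c * bergman_norm D z u"
proof -
  obtain B where B: "\<And>x y. x \<in> D \<Longrightarrow> y \<in> D \<Longrightarrow> dist x y \<le> B" "B > 0"
  proof -
    obtain B where "B > 0" "\<And>x. x \<in> D \<Longrightarrow> norm x \<le> B"
      using bounded_D unfolding bounded_pos by blast
    moreover have "dist x y \<le> 2 * B" if "norm x \<le> B" "norm y \<le> B" for x y :: "complex ^ 'n"
      unfolding dist_norm using norm_triangle_ineq4[of x y] that by linarith
    ultimately show ?thesis by (intro that[of "2 * B"]) auto
  qed
  show ?thesis
  proof (rule that[of "sqrt 2 * B"])
    show "norm u \<le> sqrt 2 * B * bergman_norm D z u" if "z \<in> D" for z u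
      by (rule bergman_norm_lower_bound[OF that]) (use B(1) that in \<open>simp add: dist_norm\<close>)
  qed (use B(2) in simp)
qed

lemma bergman_norm_pos: "z \<in> D \<Longrightarrow> u \<noteq> 0 \<Longrightarrow> bergman_norm D z u > 0"
  using norm_le_const_bergman_norm by (metis mult_zero_right norm_le_zero_iff order_le_less bergman_norm_nonneg)

text \<open>The coordinate functions have bounded derivatives in the Bergman norm, so they are Lipschitz
  for the Bergman distance.\<close>

lemma bergman_dist_pos:
  assumes "z \<in> D" "w \<in> D" "z \<noteq> w"
  shows "bergman_dist D z w > 0"
proof -
  obtain c where c: "c > 0" "\<And>z u. z \<in> D \<Longrightarrow> norm u \<le> c * bergman_norm D z u"
    by (rule norm_le_const_bergman_norm) (rule that; assumption)
  obtain i where i: "z $ i \<noteq> w $ i" using assms(3) by (auto simp: vec_eq_iff)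
  have "cmod (z $ i - w $ i) \<le> c * bergman_dist D z w"
  proof (rule lipschitz_if_bergman_norm_bound[OF holomorphic_scv_component])
    show "cmod (grad_apply (\<lambda>z. z $ i) z u) \<le> c * bergman_norm D z u" if "z \<in> D" for z u
      unfolding grad_apply_component using Finite_Cartesian_Product.norm_nth_le c(2)[OF that] by (rule order_trans)
  qed (use assms c(1) in auto)
  moreover have "cmod (z $ i - w $ i) > 0" using i by simp
  ultimately have "c * bergman_dist D z w > 0" by linarith
  then show ?thesis using c(1) by (simp add: zero_less_mult_iff)
qed

end

section \<open>Bloch functions and Lipschitz functions\<close>

context bounded_domain begin

lemma bloch_const_le_iff:
  assumes "b \<ge> 0"
  shows "bloch_const D f \<le> ereal b \<longleftrightarrow>
    (\<forall>z\<in>D. \<forall>u. cmod (grad_apply f z u) \<le> b * bergman_norm D z u)"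
proof -
  have "cmod (grad_apply f z u) / bergman_norm D z u \<le> b \<longleftrightarrow>
      cmod (grad_apply f z u) \<le> b * bergman_norm D z u" if "z \<in> D" "u \<noteq> 0" for z u
    using bergman_norm_pos[OF that] by (simp add: divide_le_eq)
  moreover have "cmod (grad_apply f z 0) \<le> b * bergman_norm D z 0" if "z \<in> D" for z
    using assms bergman_norm_nonneg[OF that] by simp
  ultimately show ?thesis
    unfolding bloch_const_def bloch_Q_def
    by (simp add: SUP_le_iff) (metis Diff_iff UNIV_I singletonD grad_apply_zero norm_zero)
qed

definition lipschitz_const :: "(complex ^ 'n \<Rightarrow> complex) \<Rightarrow> ereal" where
  "lipschitz_const f = (SUP (z, w)\<in>{(z, w). z \<in> D \<and> w \<in> D \<and> z \<noteq> w}.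
    ereal (cmod (f z - f w) / bergman_dist D z w))"

lemma lipschitz_const_le_iff:
  assumes "b \<ge> 0"
  shows "lipschitz_const f \<le> ereal b \<longleftrightarrow>
    (\<forall>z\<in>D. \<forall>w\<in>D. cmod (f z - f w) \<le> b * bergman_dist D z w)"
proof -
  have "cmod (f z - f w) / bergman_dist D z w \<le> b \<longleftrightarrow> cmod (f z - f w) \<le> b * bergman_dist D z w"
    if "z \<in> D" "w \<in> D" "z \<noteq> w" for z w
    using bergman_dist_pos[OF that] by (simp add: divide_le_eq)
  moreover have "cmod (f z - f z) \<le> b * bergman_dist D z z" if "z \<in> D" for z
    using assms bergman_dist_nonneg[OF that that] by simp
  ultimately show ?thesis
    unfolding lipschitz_const_def by (simp add: SUP_le_iff) (metis diff_self norm_zero)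
qed

lemma bloch_const_le_iff_lipschitz_const_le:
  assumes "holomorphic_scv D f" "b \<ge> 0"
  shows "bloch_const D f \<le> ereal b \<longleftrightarrow> lipschitz_const f \<le> ereal b"
  unfolding bloch_const_le_iff[OF assms(2)] lipschitz_const_le_iff[OF assms(2)]
  using lipschitz_if_bergman_norm_bound[OF assms(1) _ assms(2)]
    bergman_norm_bound_if_lipschitz[OF assms(1) _ assms(2)] by blast

lemma bloch_const_nonneg:
  assumes "D \<noteq> {}"
  shows "0 \<le> bloch_const D f"
proof -
  obtain z where z: "z \<in> D" using assms by blast
  have "(axis undefined 1 :: complex ^ 'n) \<noteq> 0" by (simp add: axis_eq_0_iff)
  then have "ereal (cmod (grad_apply f z (axis undefined 1)) / bergman_norm D z (axis undefined 1))
      \<le> bloch_Q D f z"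
    unfolding bloch_Q_def by (intro SUP_upper) simp
  also have "\<dots> \<le> bloch_const D f" unfolding bloch_const_def using z by (rule SUP_upper)
  finally show ?thesis
    using bergman_norm_nonneg[OF z] by (meson divide_nonneg_nonneg ereal_less_eq(5) norm_ge_zero order_trans)
qed

lemma lipschitz_const_nonneg:
  assumes "D \<noteq> {}"
  shows "0 \<le> lipschitz_const f"
proof -
  obtain z where z: "z \<in> D" using assms by blast
  then obtain w where w: "w \<in> D" "w \<noteq> z"
    using open_D not_open_singleton[of z] by (metis is_singletonI' is_singleton_def empty_iff singletonD)
  have "ereal (cmod (f z - f w) / bergman_dist D z w) \<le> lipschitz_const f"
    unfolding lipschitz_const_def by (rule SUP_upper2[of "(z, w)"]) (use z w in auto)
  then show ?thesis
    using bergman_dist_nonneg[OF z w(1)]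
    by (meson divide_nonneg_nonneg ereal_less_eq(5) norm_ge_zero order_trans)
qed

lemma bloch_const_eq_lipschitz_const:
  assumes "D \<noteq> {}" "holomorphic_scv D f"
  shows "bloch_const D f = lipschitz_const f"
proof (rule antisym)
  show "bloch_const D f \<le> lipschitz_const f"
    using lipschitz_const_nonneg[OF assms(1), of f] bloch_const_le_iff_lipschitz_const_le[OF assms(2)]
    by (cases "lipschitz_const f") auto
  show "lipschitz_const f \<le> bloch_const D f"
    using bloch_const_nonneg[OF assms(1), of f] bloch_const_le_iff_lipschitz_const_le[OF assms(2)]
    by (cases "bloch_const D f") auto
qed

lemma bergman_lipschitz_iff: "bergman_lipschitz D f \<longleftrightarrow> (\<exists>b\<ge>0. lipschitz_const f \<le> ereal b)"
proof
  assume "bergman_lipschitz D f"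
  then obtain L where L: "\<And>z w. z \<in> D \<Longrightarrow> w \<in> D \<Longrightarrow> cmod (f z - f w) \<le> L * bergman_dist D z w"
    unfolding bergman_lipschitz_def dist_norm by blast
  have "cmod (f z - f w) \<le> max L 0 * bergman_dist D z w" if "z \<in> D" "w \<in> D" for z w
    using L[OF that] mult_right_mono[of L "max L 0" "bergman_dist D z w"] bergman_dist_nonneg[OF that]
    by simp
  then show "\<exists>b\<ge>0. lipschitz_const f \<le> ereal b"
    by (intro exI[of _ "max L 0"] conjI lipschitz_const_le_iff[THEN iffD2] ballI) auto
next
  assume "\<exists>b\<ge>0. lipschitz_const f \<le> ereal b"
  then obtain b where "b \<ge> 0" "lipschitz_const f \<le> ereal b" by blast
  then show "bergman_lipschitz D f"
    unfolding bergman_lipschitz_def dist_norm by (intro exI[of _ b]) (simp add: lipschitz_const_le_iff)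
qed

end

theorem theorem3p1:
  fixes D :: "(complex ^ 'n) set" and f :: "complex ^ 'n \<Rightarrow> complex"
  assumes "bounded_homogeneous_domain D"
    and "holomorphic_scv D f"
  shows "(is_bloch D f \<longleftrightarrow> bergman_lipschitz D f) \<and>
    bloch_const D f =
      (SUP (z, w)\<in>{(z, w). z \<in> D \<and> w \<in> D \<and> z \<noteq> w}.
         ereal (cmod (f z - f w) / bergman_dist D z w))"
proof -
  interpret bounded_domain D
    using assms(1) unfolding bounded_homogeneous_domain_def by unfold_locales auto
  have D: "D \<noteq> {}" using assms(1) by (simp add: bounded_homogeneous_domain_def)
  have eq: "bloch_const D f = lipschitz_const f"
    by (rule bloch_const_eq_lipschitz_const[OF D assms(2)])
  have "lipschitz_const f < \<infinity> \<longleftrightarrow> (\<exists>b\<ge>0. lipschitz_const f \<le> ereal b)"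
    using lipschitz_const_nonneg[OF D, of f] by (cases "lipschitz_const f") auto
  then show ?thesis
    using eq unfolding is_bloch_def bergman_lipschitz_iff lipschitz_const_def by simp
qed

end
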